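(* For each positive integer $k$, the Sekine quantum group $\mathcal{A}_k$ is nilpotent as a semisimple Hopf algebra. In particular, the Sekine quantum group $\mathcal{A}_{15}$ is a solvable Hopf algebra of dimension $2\times 3^2\times 5^2$.
   Context: All vector spaces and algebras are over $\mathbb{C}$; $\mathbb{M}_k$ is the algebra of complex $k\times k$ matrices, $\mathbb{Z}_k=\mathbb{Z}/k\mathbb{Z}$, and $\delta_{ij}$ is Kronecker's delta on $\mathbb{Z}_k$. **Sekine quantum groups.** Let $k$ be a positive integer and $\eta=\exp(2\pi\sqrt{-1}/k)$. As a $*$-algebra $\mathcal{A}_k=\bigl(\bigoplus_{i,j\in\mathbb{Z}_k}\mathbb{C}d_{ij}\bigr)\oplus\mathbb{M}_k$, where the $d_{ij}$ are self-adjoint idempotents with $d_{ij}d_{rs}=\delta_{ir}\delta_{js}d_{ij}$; let $e_{ij}$ ($i,j\in\mathbb{Z}_k$) be the matrix units of $\mathbb{M}_k$. The Hopf $*$-algebra structure is, for $i,j\in\mathbb{Z}_k$ (indices taken in $\mathbb{Z}_k$), $$\Delta(d_{ij})=\sum_{m,n\in\mathbb{Z}_k}d_{mn}\otimes d_{i-m,j-n}+\frac1k\sum_{m,n\in\mathbb{Z}_k}\eta^{i(m-n)}e_{mn}\otimes e_{m+j,n+j},$$ $$\Delta(e_{ij})=\sum_{m,n\in\mathbb{Z}_k}\eta^{m(i-j)}d_{-m,-n}\otimes e_{i-n,j-n}+\sum_{m,n\in\mathbb{Z}_k}\eta^{m(j-i)}e_{i-n,j-n}\otimes d_{mn},$$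 $$\epsilon(d_{ij})=\delta_{i0}\delta_{j0},\quad \epsilon(e_{ij})=0,\quad S(d_{ij})=d_{-i,-j},\quad S(e_{ij})=e_{ji}.$$ **Definitions.** Let $A$ be a semisimple Hopf algebra, with Sweedler notation $\Delta(a)=a_{(1)}\otimes a_{(2)}$. For $a,b\in A$ put $a\bullet_{\mathrm{ad}} b=a_{(1)}\,b\,S(a_{(2)})$. A unital left coideal subalgebra of $A$ is a unital subalgebra $L\subseteq A$ with $\Delta(L)\subseteq A\otimes L$; it is normal if $a\bullet_{\mathrm{ad}} x\in L$ for all $a\in A$, $x\in L$. An integral of $L$ is a nonzero element $l\in L$ with $lx=xl=\epsilon(x)l$ for all $x\in L$ (unique up to a nonzero scalar). $Z(\cdot)$ denotes the center of an algebra. $A$ is nilpotent if it has a chain of normal unital left coideal subalgebras $\mathbb{C}1=L_0\subset L_1\subset\cdots\subset L_i=A$ such that $L_{j+1}l_j\subset Z(Al_j)$ for all $0\le j\le i-1$, where $l_j$ is the integral of $L_j$ and $Al_j=\{al_j: a\in A\}$. $A$ is solvable if it has a chain of unital left coideal subalgebras $\mathbb{C}1=L_0\subset L_1\subset\cdots\subset L_i=A$ such that for all $0\le j\le i-1$, with $l_j$ the integral of $L_j$: (1) $l_j\in Z(L_{j+1})$; (2) $(a\bullet_{\mathrm{ad}} b)\,l_j=\epsilon(a)\,b\,l_j$ for all $a,b\in L_{j+1}$. *)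

theory Defs
  imports Complex_Main "HOL-Library.Function_Algebras"
begin

text \<open>
  Semisimple Hopf algebras are finite-dimensional, so a Hopf algebra is given here on a space with
  a chosen finite basis \<open>B\<close>: its elements are the functions \<open>x :: 'b \<Rightarrow> complex\<close> vanishing outside
  \<open>B\<close> (with \<open>x b\<close> the coefficient of \<open>b\<close>), and its tensor square consists of the
  functions \<open>'b \<times> 'b \<Rightarrow> complex\<close> vanishing outside \<open>B \<times> B\<close>. The structure maps are prescribed on
  basis elements and extended (bi)linearly.
\<close>

definition cscale :: "complex \<Rightarrow> ('b \<Rightarrow> complex) \<Rightarrow> 'b \<Rightarrow> complex"  (infixr \<open>*\<^sub>C\<close> 75)
  where "c *\<^sub>C x = (\<lambda>b. c * x b)"

global_interpretation cfun: vector_space cscale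
  by unfold_locales (simp_all add: cscale_def fun_eq_iff algebra_simps)

definition bvec :: "'b \<Rightarrow> 'b \<Rightarrow> complex"
  where "bvec b = (\<lambda>p. if p = b then 1 else 0)"

definition tensor :: "('b \<Rightarrow> complex) \<Rightarrow> ('c \<Rightarrow> complex) \<Rightarrow> 'b \<times> 'c \<Rightarrow> complex"  (infixr \<open>\<otimes>\<close> 70)
  where "x \<otimes> y = (\<lambda>(p, q). x p * y q)"

record 'b hopf_data =
  basis :: "'b set"
  mult_basis :: "'b \<Rightarrow> 'b \<Rightarrow> 'b \<Rightarrow> complex"
  unity :: "'b \<Rightarrow> complex"
  comult_basis :: "'b \<Rightarrow> 'b \<times> 'b \<Rightarrow> complex"
  counit_basis :: "'b \<Rightarrow> complex"
  antipode_basis :: "'b \<Rightarrow> 'b \<Rightarrow> complex"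

definition hspace :: "'b hopf_data \<Rightarrow> ('b \<Rightarrow> complex) set"
  where "hspace H = {x. \<forall>b. b \<notin> basis H \<longrightarrow> x b = 0}"

definition mult :: "'b hopf_data \<Rightarrow> ('b \<Rightarrow> complex) \<Rightarrow> ('b \<Rightarrow> complex) \<Rightarrow> 'b \<Rightarrow> complex"
  where "mult H x y = (\<Sum>p\<in>basis H. \<Sum>q\<in>basis H. (x p * y q) *\<^sub>C mult_basis H p q)"

definition comult :: "'b hopf_data \<Rightarrow> ('b \<Rightarrow> complex) \<Rightarrow> 'b \<times> 'b \<Rightarrow> complex"
  where "comult H x = (\<Sum>p\<in>basis H. x p *\<^sub>C comult_basis H p)"

definition counit :: "'b hopf_data \<Rightarrow> ('b \<Rightarrow> complex) \<Rightarrow> complex"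
  where "counit H x = (\<Sum>p\<in>basis H. x p * counit_basis H p)"

definition antipode :: "'b hopf_data \<Rightarrow> ('b \<Rightarrow> complex) \<Rightarrow> 'b \<Rightarrow> complex"
  where "antipode H x = (\<Sum>p\<in>basis H. x p *\<^sub>C antipode_basis H p)"

text \<open>
  Sweedler notation: for a bilinear map \<open>F\<close>, \<open>sweedler H F x\<close> is \<open>F(x\<^sub>(\<^sub>1\<^sub>), x\<^sub>(\<^sub>2\<^sub>))\<close>, that is, the
  linear map induced by \<open>F\<close> on the tensor square, applied to \<open>comult H x\<close>.
\<close>

definition sweedler ::
    "'b hopf_data \<Rightarrow> (('b \<Rightarrow> complex) \<Rightarrow> ('b \<Rightarrow> complex) \<Rightarrow> 'c \<Rightarrow> complex) \<Rightarrow> ('b \<Rightarrow> complex) \<Rightarrow> 'c \<Rightarrow> complex"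
  where "sweedler H F x =
    (\<Sum>p\<in>basis H. \<Sum>q\<in>basis H. comult H x (p, q) *\<^sub>C F (bvec p) (bvec q))"

locale hopf_algebra =
  fixes H :: "'b hopf_data"
  assumes finite_basis: "finite (basis H)"
    and mult_basis_closed: "\<lbrakk>p \<in> basis H; q \<in> basis H\<rbrakk> \<Longrightarrow> mult_basis H p q \<in> hspace H"
    and unity_closed: "unity H \<in> hspace H"
    and comult_basis_closed:
      "\<lbrakk>p \<in> basis H; t \<notin> basis H \<times> basis H\<rbrakk> \<Longrightarrow> comult_basis H p t = 0"
    and antipode_basis_closed: "p \<in> basis H \<Longrightarrow> antipode_basis H p \<in> hspace H"
    and mult_assoc: "\<lbrakk>x \<in> hspace H; y \<in> hspace H; z \<in> hspace H\<rbrakk>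
      \<Longrightarrow> mult H (mult H x y) z = mult H x (mult H y z)"
    and mult_unity_left: "x \<in> hspace H \<Longrightarrow> mult H (unity H) x = x"
    and mult_unity_right: "x \<in> hspace H \<Longrightarrow> mult H x (unity H) = x"
    and comult_coassoc: "x \<in> hspace H \<Longrightarrow>
      sweedler H (\<lambda>u v (p, q, r). (comult H u \<otimes> v) ((p, q), r)) x =
      sweedler H (\<lambda>u v. u \<otimes> comult H v) x"
    and counit_left: "x \<in> hspace H \<Longrightarrow> sweedler H (\<lambda>u v. counit H u *\<^sub>C v) x = x"
    and counit_right: "x \<in> hspace H \<Longrightarrow> sweedler H (\<lambda>u v. counit H v *\<^sub>C u) x = x"
    and comult_mult: "\<lbrakk>x \<in> hspace H; y \<in> hspace H\<rbrakk> \<Longrightarrow>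
      comult H (mult H x y) =
      sweedler H (\<lambda>x\<^sub>1 x\<^sub>2. sweedler H (\<lambda>y\<^sub>1 y\<^sub>2. mult H x\<^sub>1 y\<^sub>1 \<otimes> mult H x\<^sub>2 y\<^sub>2) y) x"
    and comult_unity: "comult H (unity H) = unity H \<otimes> unity H"
    and counit_mult: "\<lbrakk>x \<in> hspace H; y \<in> hspace H\<rbrakk>
      \<Longrightarrow> counit H (mult H x y) = counit H x * counit H y"
    and counit_unity: "counit H (unity H) = 1"
    and antipode_left: "x \<in> hspace H \<Longrightarrow>
      sweedler H (\<lambda>u v. mult H (antipode H u) v) x = counit H x *\<^sub>C unity H"
    and antipode_right: "x \<in> hspace H \<Longrightarrow>
      sweedler H (\<lambda>u v. mult H u (antipode H v)) x = counit H x *\<^sub>C unity H"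

definition left_ideal :: "'b hopf_data \<Rightarrow> ('b \<Rightarrow> complex) set \<Rightarrow> bool"
  where "left_ideal H I \<longleftrightarrow> I \<subseteq> hspace H \<and> cfun.subspace I \<and>
    (\<forall>a\<in>hspace H. \<forall>x\<in>I. mult H a x \<in> I)"

text \<open>Semisimple: every submodule of the left regular module is a direct summand.\<close>

locale semisimple_hopf_algebra = hopf_algebra +
  assumes left_ideal_complemented: "left_ideal H I \<Longrightarrow>
    \<exists>J. left_ideal H J \<and> I \<inter> J = {0} \<and> {x + y |x y. x \<in> I \<and> y \<in> J} = hspace H"

definition adj :: "'b hopf_data \<Rightarrow> ('b \<Rightarrow> complex) \<Rightarrow> ('b \<Rightarrow> complex) \<Rightarrow> 'b \<Rightarrow> complex"
  where "adj H a b = sweedler H (\<lambda>a\<^sub>1 a\<^sub>2. mult H (mult H a\<^sub>1 b) (antipode H a\<^sub>2)) a"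

definition unital_subalgebra :: "'b hopf_data \<Rightarrow> ('b \<Rightarrow> complex) set \<Rightarrow> bool"
  where "unital_subalgebra H L \<longleftrightarrow> L \<subseteq> hspace H \<and> cfun.subspace L \<and> unity H \<in> L \<and>
    (\<forall>x\<in>L. \<forall>y\<in>L. mult H x y \<in> L)"

definition left_coideal_subalgebra :: "'b hopf_data \<Rightarrow> ('b \<Rightarrow> complex) set \<Rightarrow> bool"
  where "left_coideal_subalgebra H L \<longleftrightarrow> unital_subalgebra H L \<and>
    comult H ` L \<subseteq> cfun.span {a \<otimes> x |a x. a \<in> hspace H \<and> x \<in> L}"

definition normal_left_coideal_subalgebra :: "'b hopf_data \<Rightarrow> ('b \<Rightarrow> complex) set \<Rightarrow> bool"
  where "normal_left_coideal_subalgebra H L \<longleftrightarrow> left_coideal_subalgebra H L \<and>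
    (\<forall>a\<in>hspace H. \<forall>x\<in>L. adj H a x \<in> L)"

definition is_integral :: "'b hopf_data \<Rightarrow> ('b \<Rightarrow> complex) set \<Rightarrow> ('b \<Rightarrow> complex) \<Rightarrow> bool"
  where "is_integral H L l \<longleftrightarrow> l \<in> L \<and> l \<noteq> 0 \<and>
    (\<forall>x\<in>L. mult H l x = counit H x *\<^sub>C l \<and> mult H x l = counit H x *\<^sub>C l)"

definition center :: "'b hopf_data \<Rightarrow> ('b \<Rightarrow> complex) set \<Rightarrow> ('b \<Rightarrow> complex) set"
  where "center H X = {z \<in> X. \<forall>x\<in>X. mult H z x = mult H x z}"

definition right_mult_set ::
    "'b hopf_data \<Rightarrow> ('b \<Rightarrow> complex) set \<Rightarrow> ('b \<Rightarrow> complex) \<Rightarrow> ('b \<Rightarrow> complex) set"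
  where "right_mult_set H X l = {mult H x l |x. x \<in> X}"

text \<open>
  Integrals are unique up to a nonzero scalar and the conditions below do not depend on that scalar;
  the existential quantifier over \<open>l\<close> therefore just names the integral of \<open>L j\<close>.
\<close>

definition nilpotent :: "'b hopf_data \<Rightarrow> bool"
  where "nilpotent H \<longleftrightarrow> (\<exists>(i::nat) L.
    L 0 = cfun.span {unity H} \<and> L i = hspace H \<and>
    (\<forall>j\<le>i. normal_left_coideal_subalgebra H (L j)) \<and>
    (\<forall>j<i. L j \<subset> L (Suc j)) \<and>
    (\<forall>j<i. \<exists>l. is_integral H (L j) l \<and>
      right_mult_set H (L (Suc j)) l \<subseteq> center H (right_mult_set H (hspace H) l)))"

definition solvable :: "'b hopf_data \<Rightarrow> bool"
  where "solvable H \<longleftrightarrow> (\<exists>(i::nat) L.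
    L 0 = cfun.span {unity H} \<and> L i = hspace H \<and>
    (\<forall>j\<le>i. left_coideal_subalgebra H (L j)) \<and>
    (\<forall>j<i. L j \<subset> L (Suc j)) \<and>
    (\<forall>j<i. \<exists>l. is_integral H (L j) l \<and>
      l \<in> center H (L (Suc j)) \<and>
      (\<forall>a\<in>L (Suc j). \<forall>b\<in>L (Suc j).
        mult H (adj H a b) l = counit H a *\<^sub>C mult H b l)))"

text \<open>
  The Sekine quantum group. The index group of order \<open>k\<close> is represented by the residues
  \<open>{0..<k}\<close>, with all index arithmetic reduced mod \<open>k\<close>; \<open>D i j\<close> and \<open>E i j\<close> index the idempotents
  and the matrix units.
\<close>

datatype sekine_index = D int int | E int int

definition residues :: "nat \<Rightarrow> int set"
  where "residues k = {0..<int k}"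

definition eta :: "nat \<Rightarrow> complex"
  where "eta k = exp (2 * complex_of_real pi * \<i> / of_nat k)"

fun sekine_mult :: "sekine_index \<Rightarrow> sekine_index \<Rightarrow> sekine_index \<Rightarrow> complex" where
  "sekine_mult (D i j) (D r s) = (if i = r \<and> j = s then bvec (D i j) else 0)"
| "sekine_mult (E i j) (E r s) = (if j = r then bvec (E i s) else 0)"
| "sekine_mult (D i j) (E r s) = 0"
| "sekine_mult (E i j) (D r s) = 0"

definition sekine_unity :: "nat \<Rightarrow> sekine_index \<Rightarrow> complex"
  where "sekine_unity k =
    (\<Sum>i\<in>residues k. \<Sum>j\<in>residues k. bvec (D i j)) + (\<Sum>i\<in>residues k. bvec (E i i))"

fun sekine_comult :: "nat \<Rightarrow> sekine_index \<Rightarrow> sekine_index \<times> sekine_index \<Rightarrow> complex" where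
  "sekine_comult k (D i j) =
    (\<Sum>m\<in>residues k. \<Sum>n\<in>residues k.
      bvec (D m n) \<otimes> bvec (D ((i - m) mod int k) ((j - n) mod int k))) +
    (1 / of_nat k) *\<^sub>C (\<Sum>m\<in>residues k. \<Sum>n\<in>residues k.
      (eta k powi (i * (m - n))) *\<^sub>C
        (bvec (E m n) \<otimes> bvec (E ((m + j) mod int k) ((n + j) mod int k))))"
| "sekine_comult k (E i j) =
    (\<Sum>m\<in>residues k. \<Sum>n\<in>residues k.
      (eta k powi (m * (i - j))) *\<^sub>C
        (bvec (D ((- m) mod int k) ((- n) mod int k)) \<otimes>
         bvec (E ((i - n) mod int k) ((j - n) mod int k)))) +
    (\<Sum>m\<in>residues k. \<Sum>n\<in>residues k.
      (eta k powi (m * (j - i))) *\<^sub>C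
        (bvec (E ((i - n) mod int k) ((j - n) mod int k)) \<otimes> bvec (D m n)))"

fun sekine_counit :: "sekine_index \<Rightarrow> complex" where
  "sekine_counit (D i j) = (if i = 0 \<and> j = 0 then 1 else 0)"
| "sekine_counit (E i j) = 0"

fun sekine_antipode :: "nat \<Rightarrow> sekine_index \<Rightarrow> sekine_index \<Rightarrow> complex" where
  "sekine_antipode k (D i j) = bvec (D ((- i) mod int k) ((- j) mod int k))"
| "sekine_antipode k (E i j) = bvec (E j i)"

definition sekine :: "nat \<Rightarrow> sekine_index hopf_data"
  where "sekine k =
    \<lparr> basis = {D i j |i j. i \<in> residues k \<and> j \<in> residues k} \<union>
              {E i j |i j. i \<in> residues k \<and> j \<in> residues k},
      mult_basis = sekine_mult,
      unity = sekine_unity k,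
      comult_basis = sekine_comult k,
      counit_basis = sekine_counit,
      antipode_basis = sekine_antipode k \<rparr>"

end

theory Submission
  imports Defs
begin

text \<open>
  The chain is \<open>\<complex>1 \<subset> span {e\<^sub>D, e\<^sub>M} \<subset> A\<close>, where \<open>e\<^sub>D\<close> and \<open>e\<^sub>M\<close> are the units of the commutative part
  and of the matrix part. The middle term is central, is isomorphic to the functions on the group of
  order two and has integral \<open>e\<^sub>D\<close>; the corner \<open>A e\<^sub>D\<close> is the commutative part, and there
  \<open>(a \<bullet> b) e\<^sub>D = \<epsilon>(a) b e\<^sub>D\<close>. For \<open>k = 1\<close> the middle term is already \<open>A\<close> and the chain stops there.

  The Hopf algebra axioms are compared coefficient by coefficient; the only analytic input is the
  orthogonality of the characters \<open>i \<mapsto> \<eta>\<^sup>i\<^sup>a\<close> of the cyclic group of order \<open>k\<close>.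
\<close>

section \<open>Coordinates in a space with a finite basis\<close>

text \<open>The middle term comes from a grading: \<Delta> sends the commutative part D into D
  \<otimes> D + M \<otimes> M and the matrix part M into D \<otimes> M + M \<otimes> D. Hence
  \<open>e\<^sub>D\<close> and \<open>e\<^sub>M\<close> multiply and comultiply like the two point
  masses on a group of order two. On D coordinates the product is pointwise and the D \<otimes> D
  part of \<Delta> is dual to addition of index pairs, which is why the corner at
  \<open>e\<^sub>D\<close> is commutative and the adjoint action is trivial there. The structure
  maps are prescribed on basis vectors, while equalities are tested at coordinates. Each map is
  therefore first transposed: for a given coordinate of the result it is determined which
  coefficients of the arguments enter. Three of the four blocks of \<Delta> then read off a single
  coefficient, up to a phase. The block M \<otimes> M is a Fourier sum over the first D index, and
  it is what makes orthogonality of characters necessary. Semisimplicity uses only the algebra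
  structure, through an averaged projection.\<close>

lemma sum_fun_eval: "(\<Sum>i\<in>A. f i) x = (\<Sum>i\<in>A. f i x)"
  by (induction A rule: infinite_finite_induct) simp_all

lemma cscale_apply [simp]: "(c *\<^sub>C x) b = c * x b"
  by (simp add: cscale_def)

lemma tensor_apply [simp]: "(x \<otimes> y) (p, q) = x p * y q"
  by (simp add: tensor_def)

lemma sum_bvec:
  assumes "finite B" "a \<in> B"
  shows "(\<Sum>p\<in>B. f p * bvec p a) = f a"
  using assms by (simp add: bvec_def if_distrib cong: if_cong)

lemma sum_bvec2:
  assumes "finite B" "a \<in> B" "b \<in> B"
  shows "(\<Sum>p\<in>B. \<Sum>q\<in>B. f p q * (bvec p a * bvec q b)) = f a b"
proof -
  have "(\<Sum>p\<in>B. \<Sum>q\<in>B. f p q * (bvec p a * bvec q b))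
      = (\<Sum>p\<in>B. (\<Sum>q\<in>B. f p q * bvec q b) * bvec p a)"
    by (simp add: sum_distrib_left mult_ac)
  then show ?thesis
    using assms by (simp add: sum_bvec)
qed

lemma bvec_expansion:
  assumes "finite B" "\<And>b. b \<notin> B \<Longrightarrow> x b = 0"
  shows "x = (\<Sum>b\<in>B. x b *\<^sub>C bvec b)"
proof
  fix a show "x a = (\<Sum>b\<in>B. x b *\<^sub>C bvec b) a"
    using assms by (cases "a \<in> B") (auto simp: sum_fun_eval bvec_def if_distrib cong: if_cong)
qed

lemma sweedler_apply:
  "sweedler H F x t = (\<Sum>p\<in>basis H. \<Sum>q\<in>basis H. comult H x (p, q) * F (bvec p) (bvec q) t)"
  by (simp add: sweedler_def sum_fun_eval)

lemma comult_apply: "comult H x t = (\<Sum>p\<in>basis H. x p * comult_basis H p t)"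
  by (simp add: comult_def sum_fun_eval)

lemma antipode_apply: "antipode H x t = (\<Sum>p\<in>basis H. x p * antipode_basis H p t)"
  by (simp add: antipode_def sum_fun_eval)

lemma mult_apply:
  "mult H x y t = (\<Sum>p\<in>basis H. \<Sum>q\<in>basis H. x p * y q * mult_basis H p q t)"
  by (simp add: mult_def sum_fun_eval)

lemma bvec_of_bool: "bvec b p = of_bool (p = b)"
  by (simp add: bvec_def)

text \<open>Kronecker deltas arrive as congruences that are rarely solved for the summation
  variable; the last hypothesis lets each use supply the solution \<open>a\<close>.\<close>

lemma sum_of_bool_unique:
  assumes "finite A" "a \<in> A" "\<And>i. i \<in> A \<Longrightarrow> P i \<longleftrightarrow> i = a"
  shows "(\<Sum>i\<in>A. f i * of_bool (P i)) = (f a :: complex)"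
proof -
  have "(\<Sum>i\<in>A. f i * of_bool (P i)) = (\<Sum>i\<in>A. if i = a then f i else 0)"
    using assms by (intro sum.cong) auto
  then show ?thesis
    using assms by simp
qed

lemma sum2_of_bool_unique:
  assumes "finite A" "finite B" "a \<in> A" "b \<in> B"
    and "\<And>i j. i \<in> A \<Longrightarrow> j \<in> B \<Longrightarrow> P i j \<longleftrightarrow> i = a \<and> j = b"
  shows "(\<Sum>i\<in>A. \<Sum>j\<in>B. f i j * of_bool (P i j)) = (f a b :: complex)"
proof -
  have "(\<Sum>i\<in>A. \<Sum>j\<in>B. f i j * of_bool (P i j)) = (\<Sum>i\<in>A. f i b * of_bool (i = a))"
  proof (intro sum.cong refl)
    fix i assume i: "i \<in> A"
    have "(\<Sum>j\<in>B. f i j * of_bool (P i j)) = (\<Sum>j\<in>B. (f i j * of_bool (i = a)) * of_bool (j = b))"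
      using assms i by (intro sum.cong) auto
    then show "(\<Sum>j\<in>B. f i j * of_bool (P i j)) = f i b * of_bool (i = a)"
      using assms by (simp add: sum_of_bool_unique)
  qed
  then show ?thesis
    using assms by (simp add: sum_of_bool_unique)
qed

text \<open>These simp rules turn sums against \<open>of_bool\<close> into cardinalities, away from the form above.\<close>

declare sum_of_bool_eq [simp del] sum_of_bool_mult_eq [simp del] sum_mult_of_bool_eq [simp del]

lemma comult_bvec:
  assumes "finite (basis H)" "p \<in> basis H"
  shows "comult H (bvec p) t = comult_basis H p t"
proof -
  have "comult H (bvec p) t = (\<Sum>q\<in>basis H. comult_basis H q t * bvec q p)"
    by (simp add: comult_apply bvec_def eq_commute mult.commute)
  with assms show ?thesis
    by (simp add: sum_bvec)
qed

lemma sum_swap22: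
  fixes f :: "'a \<Rightarrow> 'b \<Rightarrow> 'c \<Rightarrow> 'd \<Rightarrow> 'e :: comm_monoid_add"
  shows
  "(\<Sum>a\<in>A. \<Sum>b\<in>B. \<Sum>c\<in>C. \<Sum>d\<in>G. f a b c d) = (\<Sum>c\<in>C. \<Sum>d\<in>G. \<Sum>a\<in>A. \<Sum>b\<in>B. f a b c d)"
proof -
  have swap3: "(\<Sum>b\<in>X. \<Sum>c\<in>C. \<Sum>d\<in>G. F b c d) = (\<Sum>c\<in>C. \<Sum>d\<in>G. \<Sum>b\<in>X. F b c d)"
    for X and F :: "'x \<Rightarrow> 'c \<Rightarrow> 'd \<Rightarrow> 'e"
    by (subst sum.swap) (intro sum.cong refl sum.swap)
  show ?thesis
    \<comment> \<open>Applied twice, to move \<open>b\<close> and then \<open>a\<close> past both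
      inner sums; \<open>swap3\<close> has a type variable of its own because these two index types
      may differ.\<close>
    unfolding swap3 by (rule refl)
qed

text \<open>Shaped for multiplicativity of \<Delta>: \<open>X\<close> and \<open>Y\<close> are the
  coefficients of two coproducts, and \<open>(f t, g t)\<close>, \<open>(h u, l u)\<close> run over
  the factorisations of the two target coordinates.\<close>

lemma sum4_bvec:
  assumes "finite B" "f ` T \<subseteq> B" "g ` T \<subseteq> B" "h ` U \<subseteq> B" "l ` U \<subseteq> B"
  shows "(\<Sum>p\<in>B. \<Sum>q\<in>B. X p q * (\<Sum>p'\<in>B. \<Sum>q'\<in>B. Y p' q' *
      ((\<Sum>t\<in>T. bvec p (f t) * bvec p' (g t)) * (\<Sum>u\<in>U. bvec q (h u) * bvec q' (l u)))))
    = (\<Sum>t\<in>T. \<Sum>u\<in>U. X (f t) (h u) * Y (g t) (l u))"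
proof -
  have "(\<Sum>p'\<in>B. \<Sum>q'\<in>B. Y p' q' *
      ((\<Sum>t\<in>T. bvec p (f t) * bvec p' (g t)) * (\<Sum>u\<in>U. bvec q (h u) * bvec q' (l u))))
    = (\<Sum>t\<in>T. \<Sum>u\<in>U. Y (g t) (l u) * (bvec p (f t) * bvec q (h u)))" for p q
  proof -
    have "(\<Sum>p'\<in>B. \<Sum>q'\<in>B. Y p' q' *
      ((\<Sum>t\<in>T. bvec p (f t) * bvec p' (g t)) * (\<Sum>u\<in>U. bvec q (h u) * bvec q' (l u))))
      = (\<Sum>t\<in>T. \<Sum>u\<in>U. \<Sum>p'\<in>B. \<Sum>q'\<in>B. (Y p' q' * (bvec p (f t) * bvec q (h u))) *
          (bvec p' (g t) * bvec q' (l u)))"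
      by (subst sum_swap22) (unfold sum_product, simp add: sum_distrib_left mult_ac)
    also have "\<dots> = (\<Sum>t\<in>T. \<Sum>u\<in>U. Y (g t) (l u) * (bvec p (f t) * bvec q (h u)))"
      using assms by (intro sum.cong refl sum_bvec2) auto
    finally show ?thesis .
  qed
  then have "(\<Sum>p\<in>B. \<Sum>q\<in>B. X p q * (\<Sum>p'\<in>B. \<Sum>q'\<in>B. Y p' q' *
      ((\<Sum>t\<in>T. bvec p (f t) * bvec p' (g t)) * (\<Sum>u\<in>U. bvec q (h u) * bvec q' (l u)))))
    = (\<Sum>t\<in>T. \<Sum>u\<in>U. \<Sum>p\<in>B. \<Sum>q\<in>B. (X p q * Y (g t) (l u)) * (bvec p (f t) * bvec q (h u)))"
    by (subst sum_swap22) (simp add: sum_distrib_left mult_ac)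
  also have "\<dots> = (\<Sum>t\<in>T. \<Sum>u\<in>U. X (f t) (h u) * Y (g t) (l u))"
    using assms by (intro sum.cong refl sum_bvec2) auto
  finally show ?thesis .
qed

text \<open>The analogue for a single coproduct, as needed in the antipode axioms.\<close>

lemma sum_bvec2_sum:
  assumes "finite B" "f ` T \<subseteq> B" "g ` T \<subseteq> B"
  shows "(\<Sum>p\<in>B. \<Sum>q\<in>B. X p q * (\<Sum>t\<in>T. bvec p (f t) * bvec q (g t))) = (\<Sum>t\<in>T. X (f t) (g t))"
proof -
  have "(\<Sum>p\<in>B. \<Sum>q\<in>B. X p q * (\<Sum>t\<in>T. bvec p (f t) * bvec q (g t)))
      = (\<Sum>t\<in>T. \<Sum>p\<in>B. \<Sum>q\<in>B. X p q * (bvec p (f t) * bvec q (g t)))"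
    by (subst sum.swap, subst (2) sum.swap) (simp add: sum_distrib_left)
  also have "\<dots> = (\<Sum>t\<in>T. X (f t) (g t))"
    using assms by (intro sum.cong refl sum_bvec2) auto
  finally show ?thesis .
qed

lemma mult_add:
  "mult H (x + y) z = mult H x z + mult H y z" "mult H z (x + y) = mult H z x + mult H z y"
  by (simp_all add: fun_eq_iff mult_apply algebra_simps sum.distrib)

lemma mult_scale:
  "mult H (c *\<^sub>C x) z = c *\<^sub>C mult H x z" "mult H z (c *\<^sub>C x) = c *\<^sub>C mult H z x"
  by (simp_all add: fun_eq_iff mult_apply sum_distrib_left mult_ac)

lemma mult_zero [simp]: "mult H 0 z = 0" "mult H z 0 = 0"
  by (simp_all add: fun_eq_iff mult_apply)

lemma mult_sum:
  "mult H (\<Sum>i\<in>A. f i) z = (\<Sum>i\<in>A. mult H (f i) z)"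
  "mult H z (\<Sum>i\<in>A. f i) = (\<Sum>i\<in>A. mult H z (f i))"
  by (induction A rule: infinite_finite_induct) (simp_all add: mult_add)

lemma subspace_hspace: "cfun.subspace (hspace H)"
  by (simp add: cfun.subspace_def hspace_def)

lemma independent_bvec:
  assumes "finite B"
  shows "cfun.independent (bvec ` B)"
proof (rule cfun.independent_if_scalars_zero)
  fix f v
  assume zero: "(\<Sum>x\<in>bvec ` B. f x *\<^sub>C x) = 0" and "v \<in> bvec ` B"
  then obtain b where b: "b \<in> B" "v = bvec b" by blast
  have inj: "inj_on bvec B"
    by (auto simp: inj_on_def bvec_def fun_eq_iff split: if_splits)
  have "0 = (\<Sum>x\<in>bvec ` B. f x *\<^sub>C x) b"
    using zero by simp
  also have "\<dots> = (\<Sum>c\<in>B. f (bvec c) * bvec c b)"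
    by (simp add: sum.reindex[OF inj] sum_fun_eval)
  finally show "f v = 0"
    using assms b by (simp add: sum_bvec)
qed (use assms in simp)

lemma dim_hspace:
  assumes "finite (basis H)"
  shows "cfun.dim (hspace H) = card (basis H)"
proof (rule cfun.dim_unique[where B = "bvec ` basis H"])
  show "hspace H \<subseteq> cfun.span (bvec ` basis H)"
  proof
    fix x assume "x \<in> hspace H"
    then have "x = (\<Sum>b\<in>basis H. x b *\<^sub>C bvec b)"
      using assms by (intro bvec_expansion) (auto simp: hspace_def)
    also have "\<dots> \<in> cfun.span (bvec ` basis H)"
      by (intro cfun.span_sum cfun.span_scale cfun.span_base) auto
    finally show "x \<in> cfun.span (bvec ` basis H)" .
  qed
  show "card (bvec ` basis H) = card (basis H)"
    by (rule card_image) (auto simp: inj_on_def bvec_def fun_eq_iff split: if_splits)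
qed (auto simp: independent_bvec assms, auto simp: hspace_def bvec_def)

section \<open>Left coideal subalgebras of a Hopf algebra\<close>

context hopf_algebra
begin

text \<open>The coideal condition for the top term of the chain, obtained by expanding the
  coefficient function in the tensors \<open>bvec p \<otimes> bvec q\<close>.\<close>

lemma comult_in_span: "comult H x \<in> cfun.span {a \<otimes> y |a y. a \<in> hspace H \<and> y \<in> hspace H}"
proof -
  have "comult H x t = (\<Sum>p\<in>basis H. \<Sum>q\<in>basis H. comult H x (p, q) *\<^sub>C (bvec p \<otimes> bvec q)) t" for t
  proof -
    obtain a b where t: "t = (a, b)" by fastforce
    have "comult H x t = (\<Sum>p\<in>basis H. \<Sum>q\<in>basis H. comult H x (p, q) * (bvec p a * bvec q b))"
    proof (cases "a \<in> basis H \<and> b \<in> basis H")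
      case True
      then show ?thesis
        by (simp add: t finite_basis sum_bvec2)
    next
      case False
      then show ?thesis
        by (auto simp: t comult_apply comult_basis_closed bvec_def intro!: sum.neutral)
    qed
    then show ?thesis
      by (simp add: t sum_fun_eval)
  qed
  then have "comult H x = (\<Sum>p\<in>basis H. \<Sum>q\<in>basis H. comult H x (p, q) *\<^sub>C (bvec p \<otimes> bvec q))"
    by blast
  also have "\<dots> \<in> cfun.span {a \<otimes> y |a y. a \<in> hspace H \<and> y \<in> hspace H}"
    by (intro cfun.span_sum cfun.span_scale cfun.span_base) (force simp: hspace_def bvec_def)
  finally show ?thesis .
qed

lemma mult_closed: "mult H x y \<in> hspace H"
  using mult_basis_closed by (auto simp: hspace_def mult_apply intro!: sum.neutral)

lemma adj_closed: "adj H a b \<in> hspace H"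
  using mult_closed by (auto simp: adj_def sweedler_apply hspace_def)

lemma antipode_closed: "antipode H x \<in> hspace H"
  using antipode_basis_closed by (auto simp: hspace_def antipode_apply intro!: sum.neutral)

text \<open>A central \<open>x\<close> can be pulled out to the left of the Sweedler sum, leaving
  \<open>x\<close> times the sum that the antipode axiom evaluates to \<epsilon>(a)1.\<close>

lemma adj_central:
  assumes "a \<in> hspace H" "x \<in> center H (hspace H)"
  shows "adj H a x = counit H a *\<^sub>C x"
proof -
  have x: "x \<in> hspace H" and comm: "\<And>y. y \<in> hspace H \<Longrightarrow> mult H y x = mult H x y"
    using assms by (auto simp: center_def)
  have b: "bvec p \<in> hspace H" if "p \<in> basis H" for p
    using that by (auto simp: hspace_def bvec_def)
  have "mult H (mult H (bvec p) x) (antipode H (bvec q)) = mult H x (mult H (bvec p) (antipode H (bvec q)))"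
    if "p \<in> basis H" "q \<in> basis H" for p q
    using that b x by (simp add: comm mult_assoc antipode_closed)
  then have "adj H a x = mult H x (sweedler H (\<lambda>u v. mult H u (antipode H v)) a)"
    by (simp add: adj_def sweedler_def mult_sum mult_scale cong: sum.cong)
  also have "\<dots> = counit H a *\<^sub>C x"
    using assms x by (simp add: antipode_right mult_scale mult_unity_right)
  finally show ?thesis .
qed

lemma normal_left_coideal_subalgebra_hspace: "normal_left_coideal_subalgebra H (hspace H)"
  using comult_in_span
  by (auto simp: normal_left_coideal_subalgebra_def left_coideal_subalgebra_def
      unital_subalgebra_def subspace_hspace unity_closed mult_closed adj_closed)

lemma normal_of_central:
  assumes "left_coideal_subalgebra H L" "L \<subseteq> center H (hspace H)"
  shows "normal_left_coideal_subalgebra H L"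
  using assms adj_central
  by (auto simp: normal_left_coideal_subalgebra_def left_coideal_subalgebra_def
      unital_subalgebra_def subset_iff intro: cfun.subspace_scale)

lemma left_coideal_subalgebra_unity: "left_coideal_subalgebra H (cfun.span {unity H})"
proof -
  have "comult H (c *\<^sub>C unity H) = c *\<^sub>C (unity H \<otimes> unity H)" for c
    unfolding comult_unity[symmetric] by (simp add: fun_eq_iff comult_apply sum_distrib_left mult.assoc)
  moreover have "c *\<^sub>C (unity H \<otimes> unity H) \<in> cfun.span {a \<otimes> y |a y. a \<in> hspace H \<and> y \<in> cfun.span {unity H}}"
    for c
    using unity_closed by (intro cfun.span_scale cfun.span_base) (blast intro: cfun.span_base)
  ultimately have "comult H ` cfun.span {unity H} \<subseteq>
      cfun.span {a \<otimes> y |a y. a \<in> hspace H \<and> y \<in> cfun.span {unity H}}"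
    unfolding cfun.span_singleton by auto
  moreover have "cfun.span {unity H} \<subseteq> hspace H"
    using unity_closed by (intro cfun.span_minimal subspace_hspace) simp
  moreover have "mult H x y \<in> cfun.span {unity H}"
    if "x \<in> cfun.span {unity H}" "y \<in> cfun.span {unity H}" for x y
    using that unity_closed
    by (auto simp: cfun.span_singleton mult_scale mult_unity_left)
  ultimately show ?thesis
    by (simp add: left_coideal_subalgebra_def unital_subalgebra_def cfun.span_base cfun.subspace_span)
qed

end

section \<open>Indices and characters of the cyclic group\<close>

locale sekine_data =
  fixes k :: nat
  assumes k_pos: "k \<ge> 1"
begin

abbreviation "H \<equiv> sekine k"
abbreviation "R \<equiv> residues k"
abbreviation "K \<equiv> int k"

lemma finite_R [simp]: "finite R"
  by (simp add: residues_def)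

lemma card_R [simp]: "card R = k"
  by (simp add: residues_def)

lemma mod_R [simp]: "i mod K \<in> R"
  using k_pos by (simp add: residues_def)

lemma R_mod: "i \<in> R \<Longrightarrow> i mod K = i"
  by (simp add: residues_def)

lemma zero_R [simp]: "0 \<in> R"
  using k_pos by (simp add: residues_def)

lemma basis_iff [simp]:
  "D i j \<in> basis H \<longleftrightarrow> i \<in> R \<and> j \<in> R"
  "E i j \<in> basis H \<longleftrightarrow> i \<in> R \<and> j \<in> R"
  by (auto simp: sekine_def)

lemma basis_eq: "basis H = (\<lambda>(i, j). D i j) ` (R \<times> R) \<union> (\<lambda>(i, j). E i j) ` (R \<times> R)"
  by (auto simp: sekine_def)

lemma finite_basis_sekine [simp]: "finite (basis H)"
  by (simp add: basis_eq)

lemma sum_basis: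
  "(\<Sum>p\<in>basis H. f p) = (\<Sum>i\<in>R. \<Sum>j\<in>R. f (D i j)) + (\<Sum>i\<in>R. \<Sum>j\<in>R. f (E i j))"
proof -
  have "(\<Sum>p\<in>basis H. f p) = (\<Sum>p\<in>(\<lambda>(i, j). D i j) ` (R \<times> R). f p)
      + (\<Sum>p\<in>(\<lambda>(i, j). E i j) ` (R \<times> R). f p)"
    unfolding basis_eq by (rule sum.union_disjoint) auto
  also have "(\<Sum>p\<in>(\<lambda>(i, j). D i j) ` (R \<times> R). f p) = (\<Sum>i\<in>R. \<Sum>j\<in>R. f (D i j))"
    by (subst sum.reindex) (auto simp: inj_on_def sum.cartesian_product case_prod_unfold)
  also have "(\<Sum>p\<in>(\<lambda>(i, j). E i j) ` (R \<times> R). f p) = (\<Sum>i\<in>R. \<Sum>j\<in>R. f (E i j))"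
    by (subst sum.reindex) (auto simp: inj_on_def sum.cartesian_product case_prod_unfold)
  finally show ?thesis .
qed

lemma sum_shift: "(\<Sum>i\<in>R. f ((i + c) mod K)) = (\<Sum>i\<in>R. f i)"
proof (rule sum.reindex_bij_witness[where i = "\<lambda>i. (i - c) mod K" and j = "\<lambda>i. (i + c) mod K"])
qed (simp_all add: mod_simps R_mod)

definition \<chi> :: "int \<Rightarrow> complex"
  where "\<chi> a = eta k powi a"

lemma \<chi>_cis: "\<chi> a = cis (2 * pi * (of_int a / of_nat k))"
proof -
  have "eta k = cis (2 * pi / of_nat k)"
    by (simp add: eta_def cis_conv_exp algebra_simps)
  then show ?thesis
    by (simp add: \<chi>_def cis_power_int mult_ac)
qed

lemma \<chi>_add: "\<chi> (a + b) = \<chi> a * \<chi> b"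
  by (simp add: \<chi>_cis cis_mult add_divide_distrib distrib_left)

lemma \<chi>_0 [simp]: "\<chi> 0 = 1"
  by (simp add: \<chi>_def)

text \<open>The character is faithful modulo \<open>K\<close>: the real part gives cos = 1, which
  forces the angle to be an integer multiple of 2 pi.\<close>

lemma \<chi>_eq_1_iff: "\<chi> a = 1 \<longleftrightarrow> K dvd a"
proof
  assume "K dvd a"
  then obtain c where "a = K * c" ..
  then show "\<chi> a = 1"
    using k_pos by (simp add: \<chi>_cis)
next
  assume "\<chi> a = 1"
  then have "cos (2 * pi * (of_int a / of_nat k)) = 1"
    unfolding \<chi>_cis by (metis Re_complex_of_real cis.simps(1) of_real_1)
  then obtain n :: int where "2 * pi * (of_int a / of_nat k) = of_int n * 2 * pi"
    by (auto simp: cos_one_2pi_int)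
  then have "of_int a / of_nat k = (of_int n :: real)"
    using k_pos by (simp add: field_simps)
  then have "(of_int a :: real) = of_int (n * K)"
    using k_pos by (simp add: field_simps)
  then show "K dvd a"
    by (metis dvd_triv_right of_int_eq_iff)
qed

lemma \<chi>_cong:
  assumes "a mod K = b mod K"
  shows "\<chi> a = \<chi> b"
  using \<chi>_add[of "a - b" b] assms by (simp add: \<chi>_eq_1_iff mod_eq_dvd_iff)

lemma \<chi>_mod [simp]: "\<chi> (a mod K) = \<chi> a"
  by (rule \<chi>_cong) simp

text \<open>Nested coproducts put reduced indices into exponents; since \<chi> depends only on the
  residue of its argument, the reductions can be erased.\<close>

lemma \<chi>_mult_diff_mod [simp]: "\<chi> (a * (u mod K - v mod K)) = \<chi> (a * (u - v))"
  by (rule \<chi>_cong) (metis mod_diff_eq mod_mult_right_eq)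

lemma \<chi>_mult_mod [simp]: "\<chi> (a mod K * b) = \<chi> (a * b)" "\<chi> (b * (a mod K)) = \<chi> (b * a)"
  by (metis \<chi>_mod mod_mult_left_eq mod_mult_right_eq)+

text \<open>Multiplication by \<open>\<chi> a\<close> only shifts the summation index by one, so the
  sum is fixed by that factor and vanishes whenever the factor differs from 1.\<close>

lemma sum_\<chi>: "(\<Sum>i\<in>R. \<chi> (i * a)) = (if K dvd a then of_nat k else 0)"
proof (cases "K dvd a")
  case True
  then have "\<chi> (i * a) = 1" for i
    by (simp add: \<chi>_eq_1_iff)
  with True show ?thesis
    by (simp add: residues_def)
next
  case False
  have "\<chi> a * (\<Sum>i\<in>R. \<chi> (i * a)) = (\<Sum>i\<in>R. \<chi> ((i + 1) mod K * a))"
  proof -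
    have "\<chi> a * \<chi> (i * a) = \<chi> ((i + 1) mod K * a)" for i
      by (simp add: distrib_right \<chi>_add)
    then show ?thesis
      by (simp add: sum_distrib_left del: \<chi>_mult_mod)
  qed
  also have "\<dots> = (\<Sum>i\<in>R. \<chi> (i * a))"
    by (rule sum_shift)
  finally show ?thesis
    using False by (simp add: \<chi>_eq_1_iff)
qed

section \<open>The structure maps in coordinates\<close>

text \<open>The pairs \<open>(lfactor a t, rfactor a t)\<close> are the basis indices whose product contributes to the
  coordinate \<open>a\<close>; for \<open>a = D i j\<close> the single value \<open>t = 0\<close> is a dummy.\<close>

fun ltrange :: "sekine_index \<Rightarrow> int set" where
  "ltrange (D i j) = {0}"
| "ltrange (E i j) = R"

fun lfactor :: "sekine_index \<Rightarrow> int \<Rightarrow> sekine_index" where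
  "lfactor (D i j) t = D i j"
| "lfactor (E i j) t = E i t"

fun rfactor :: "sekine_index \<Rightarrow> int \<Rightarrow> sekine_index" where
  "rfactor (D i j) t = D i j"
| "rfactor (E i j) t = E t j"

lemma finite_ltrange [simp]: "finite (ltrange a)"
  by (cases a) simp_all

lemma factor_basis [simp]:
  assumes "a \<in> basis H" "t \<in> ltrange a"
  shows "lfactor a t \<in> basis H" "rfactor a t \<in> basis H"
  using assms by (cases a; simp)+

lemma sekine_sel [simp]:
  "mult_basis H = sekine_mult" "unity H = sekine_unity k" "comult_basis H = sekine_comult k"
  "counit_basis H = sekine_counit" "antipode_basis H = sekine_antipode k"
  by (simp_all add: sekine_def)

text \<open>The transposed product: in the dual coalgebra a \<open>D\<close> coordinate is
  group-like and the \<open>E\<close> coordinates form a matrix coalgebra.\<close>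

lemma mult_basis_sekine:
  assumes "p \<in> basis H" "q \<in> basis H"
  shows "sekine_mult p q a = (\<Sum>t\<in>ltrange a. bvec p (lfactor a t) * bvec q (rfactor a t))"
  using assms
  by (cases p; cases q; cases a) (auto simp: bvec_of_bool sum_of_bool_unique sum_of_bool_unique[where f = "\<lambda>_. 1", simplified]
      intro!: sum.neutral simp flip: of_bool_conj)

lemma mult_coord:
  assumes "a \<in> basis H"
  shows "mult H x y a = (\<Sum>t\<in>ltrange a. x (lfactor a t) * y (rfactor a t))"
proof -
  have "mult H x y a = (\<Sum>p\<in>basis H. \<Sum>q\<in>basis H. \<Sum>t\<in>ltrange a.
      (x p * y q) * (bvec p (lfactor a t) * bvec q (rfactor a t)))"
    by (simp add: mult_apply mult_basis_sekine sum_distrib_left cong: sum.cong)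
  also have "\<dots> = (\<Sum>t\<in>ltrange a. \<Sum>p\<in>basis H. \<Sum>q\<in>basis H.
      (x p * y q) * (bvec p (lfactor a t) * bvec q (rfactor a t)))"
    by (subst sum.swap, subst (2) sum.swap) (rule refl)
  also have "\<dots> = (\<Sum>t\<in>ltrange a. x (lfactor a t) * y (rfactor a t))"
    using assms by (intro sum.cong refl sum_bvec2) auto
  finally show ?thesis .
qed

lemma mult_outside: "a \<notin> basis H \<Longrightarrow> mult H x y a = 0"
proof -
  assume a: "a \<notin> basis H"
  have "sekine_mult p q a = 0" if "p \<in> basis H" "q \<in> basis H" for p q
    using that a by (cases p; cases q) (auto simp: bvec_def)
  then show ?thesis
    by (simp add: mult_apply)
qed

lemma counit_coord: "counit H x = x (D 0 0)"
proof -
  have "counit H x = (\<Sum>p\<in>basis H. x p * bvec p (D 0 0))"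
    unfolding counit_def sekine_sel
  proof (intro sum.cong refl)
    fix p show "x p * sekine_counit p = x p * bvec p (D 0 0)"
      by (cases p) (auto simp: bvec_def)
  qed
  then show ?thesis
    by (simp add: sum_bvec)
qed

fun neg_index :: "sekine_index \<Rightarrow> sekine_index" where
  "neg_index (D i j) = D ((- i) mod K) ((- j) mod K)"
| "neg_index (E i j) = E j i"

lemma neg_index_basis [simp]: "a \<in> basis H \<Longrightarrow> neg_index a \<in> basis H"
  by (cases a) auto

lemma neg_mod_eq_iff: "i \<in> R \<Longrightarrow> j \<in> R \<Longrightarrow> i = - j mod K \<longleftrightarrow> j = - i mod K"
  by (metis R_mod add.inverse_inverse mod_minus_eq)

text \<open>The antipode permutes the basis by an involution, so the inverse permutation, which
  governs coefficients, is again \<open>neg_index\<close>.\<close>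

lemma antipode_basis_sekine:
  assumes "p \<in> basis H" "a \<in> basis H"
  shows "sekine_antipode k p a = bvec p (neg_index a)"
  using assms by (cases p; cases a) (auto simp: bvec_def neg_mod_eq_iff)

lemma antipode_coord:
  assumes "a \<in> basis H"
  shows "antipode H x a = x (neg_index a)"
  using assms by (simp add: antipode_apply antipode_basis_sekine sum_bvec cong: sum.cong)

lemma unity_coord:
  assumes "i \<in> R" "j \<in> R"
  shows "sekine_unity k (D i j) = 1" "sekine_unity k (E i j) = of_bool (i = j)"
proof -
  have "(\<Sum>i'\<in>R. \<Sum>j'\<in>R. 1 * of_bool (i = i' \<and> j = j')) = (1 :: complex)"
    using assms by (intro sum2_of_bool_unique[where a = i and b = j]) auto
  then show "sekine_unity k (D i j) = 1"
    by (simp add: sekine_unity_def sum_fun_eval bvec_of_bool)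
  have "(\<Sum>i'\<in>R. of_bool (j = i') * of_bool (i = i')) = (of_bool (j = i) :: complex)"
    using assms by (intro sum_of_bool_unique) auto
  then show "sekine_unity k (E i j) = of_bool (i = j)"
    by (simp add: sekine_unity_def sum_fun_eval bvec_of_bool conj_commute eq_commute flip: of_bool_conj)
qed

lemma unity_outside: "a \<notin> basis H \<Longrightarrow> sekine_unity k a = 0"
  by (cases a) (auto simp: sekine_unity_def sum_fun_eval bvec_def intro!: sum.neutral)

lemma eq_sub_mod_iff: "r \<in> R \<Longrightarrow> i \<in> R \<Longrightarrow> r = (i - m) mod K \<longleftrightarrow> i = (m + r) mod K"
  by (metis R_mod add.commute diff_add_cancel mod_add_right_eq mod_diff_left_eq
      add_diff_cancel_left')

section \<open>Coefficients of the coproduct, block by block\<close>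

lemma comult_basis_outside:
  assumes "p \<in> basis H" "t \<notin> basis H \<times> basis H"
  shows "sekine_comult k p t = 0"
proof -
  have "a \<noteq> D m n" "a \<noteq> E m n" if "a \<notin> basis H" "m \<in> R" "n \<in> R" for a m n
    using that by auto
  then show ?thesis
    using assms by (cases p; cases t) (auto simp: sum_fun_eval bvec_of_bool cong: sum.cong)
qed

lemma comult_basis_DD:
  assumes "p \<in> basis H" "m \<in> R" "n \<in> R" "r \<in> R" "s \<in> R"
  shows "sekine_comult k p (D m n, D r s) = bvec p (D ((m + r) mod K) ((n + s) mod K))"
proof (cases p)
  case (D i j)
  have "(\<Sum>m'\<in>R. \<Sum>n'\<in>R. of_bool (r = (i - m') mod K \<and> s = (j - n') mod K) *
      of_bool (m = m' \<and> n = n')) = (of_bool (r = (i - m) mod K \<and> s = (j - n) mod K) :: complex)"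
    using assms by (intro sum2_of_bool_unique) auto
  then show ?thesis
    using assms D by (auto simp: sum_fun_eval bvec_of_bool eq_sub_mod_iff mult.commute)
qed (simp add: sum_fun_eval bvec_of_bool)

text \<open>Only this block involves several basis elements for one pair of coordinates: the shift
  fixes \<open>j\<close>, but \<open>i\<close> stays free. This is the source of the Fourier
  sums.\<close>

lemma comult_basis_EE:
  assumes "m \<in> R" "n \<in> R"
  shows "sekine_comult k (D i j) (E m n, E r s) =
      \<chi> (i * (m - n)) / k * of_bool (r = (m + j) mod K \<and> s = (n + j) mod K)"
    "sekine_comult k (E i j) (E m n, E r s) = 0"
proof -
  have "(\<Sum>m'\<in>R. \<Sum>n'\<in>R. (\<chi> (i * (m' - n')) * of_bool (r = (m' + j) mod K \<and> s = (n' + j) mod K)) *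
      of_bool (m = m' \<and> n = n')) = \<chi> (i * (m - n)) * of_bool (r = (m + j) mod K \<and> s = (n + j) mod K)"
    using assms by (intro sum2_of_bool_unique) auto
  then show "sekine_comult k (D i j) (E m n, E r s) =
      \<chi> (i * (m - n)) / k * of_bool (r = (m + j) mod K \<and> s = (n + j) mod K)"
    by (auto simp: sum_fun_eval bvec_of_bool mult_ac simp flip: \<chi>_def)
qed (simp add: sum_fun_eval bvec_of_bool)

lemma comult_basis_DE:
  assumes "p \<in> basis H" "m \<in> R" "n \<in> R" "r \<in> R" "s \<in> R"
  shows "sekine_comult k p (D m n, E r s) =
    \<chi> (m * (s - r)) * bvec p (E ((r - n) mod K) ((s - n) mod K))"
proof (cases p)
  case (E i j)
  \<comment> \<open>The \<open>D\<close> indices in \<Delta>(e_ij) carry a minus sign, so the deltas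
    are solved by \<open>m' = - m\<close> and \<open>n' = - n\<close> modulo
    \<open>K\<close>.\<close>
  have *: "(m = - m' mod K \<and> n = - n' mod K) \<longleftrightarrow> m' = - m mod K \<and> n' = - n mod K"
    if "m' \<in> R" "n' \<in> R" for m' n'
    using assms that neg_mod_eq_iff[of m m'] neg_mod_eq_iff[of n n'] by blast
  have "(\<Sum>m'\<in>R. \<Sum>n'\<in>R. (\<chi> (m' * (i - j)) * of_bool (r = (i - n') mod K \<and> s = (j - n') mod K)) *
      of_bool (m = - m' mod K \<and> n = - n' mod K))
    = \<chi> (- m mod K * (i - j)) * of_bool (r = (i - (- n mod K)) mod K \<and> s = (j - (- n mod K)) mod K)"
    using * by (intro sum2_of_bool_unique) auto
  \<comment> \<open>A common shift by \<open>n\<close> leaves the difference of matrix indices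
    unchanged, so \<open>i - j\<close> is congruent to \<open>r - s\<close>; the minus sign from
    \<open>- m\<close> reverses it.\<close>
  also have "\<dots> = \<chi> (m * (s - r)) * of_bool (i = (r - n) mod K \<and> j = (s - n) mod K)"
  proof (cases "i = (r - n) mod K \<and> j = (s - n) mod K")
    case True
    then show ?thesis
      using assms by (auto simp: mod_simps R_mod) (simp add: algebra_simps)
  next
    case False
    then show ?thesis
      using assms E by (auto simp: mod_simps R_mod)
  qed
  finally show ?thesis
    using E by (auto simp: sum_fun_eval bvec_of_bool mult_ac simp flip: \<chi>_def)
qed (simp add: sum_fun_eval bvec_of_bool)

lemma comult_basis_ED:
  assumes "p \<in> basis H" "m \<in> R" "n \<in> R" "r \<in> R" "s \<in> R"
  shows "sekine_comult k p (E m n, D r s) =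
    \<chi> (r * (n - m)) * bvec p (E ((m + s) mod K) ((n + s) mod K))"
proof (cases p)
  case (E i j)
  have "(\<Sum>m'\<in>R. \<Sum>n'\<in>R. (\<chi> (m' * (j - i)) * of_bool (m = (i - n') mod K \<and> n = (j - n') mod K)) *
      of_bool (r = m' \<and> s = n'))
    = \<chi> (r * (j - i)) * of_bool (m = (i - s) mod K \<and> n = (j - s) mod K)"
    using assms by (intro sum2_of_bool_unique) auto
  also have "\<dots> = \<chi> (r * (n - m)) * of_bool (i = (m + s) mod K \<and> j = (n + s) mod K)"
  proof (cases "i = (m + s) mod K \<and> j = (n + s) mod K")
    case True
    then show ?thesis
      using assms by (auto simp: mod_simps R_mod)
  next
    case False
    then show ?thesis
      using assms E by (auto simp: mod_simps R_mod eq_sub_mod_iff add.commute)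
  qed
  finally show ?thesis
    using E by (auto simp: sum_fun_eval bvec_of_bool mult_ac simp flip: \<chi>_def)
qed (simp add: sum_fun_eval bvec_of_bool)

text \<open>The blocks DE and ED translate both matrix indices and attach a phase. The block EE is a
  Fourier transform in the first \<open>D\<close> index at frequency \<open>m - n\<close>, supported
  where both index pairs differ by the same shift.\<close>

lemma comult_coord:
  assumes "m \<in> R" "n \<in> R" "r \<in> R" "s \<in> R"
  shows "comult H x (D m n, D r s) = x (D ((m + r) mod K) ((n + s) mod K))"
    "comult H x (D m n, E r s) = \<chi> (m * (s - r)) * x (E ((r - n) mod K) ((s - n) mod K))"
    "comult H x (E m n, D r s) = \<chi> (r * (n - m)) * x (E ((m + s) mod K) ((n + s) mod K))"
    "comult H x (E m n, E r s) =
      (\<Sum>i\<in>R. \<chi> (i * (m - n)) * x (D i ((r - m) mod K))) / k * of_bool (K dvd (r - m) - (s - n))"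
proof -
  show "comult H x (D m n, D r s) = x (D ((m + r) mod K) ((n + s) mod K))"
    using assms by (simp add: comult_apply comult_basis_DD sum_bvec cong: sum.cong)
  have "comult H x (D m n, E r s) = (\<Sum>p\<in>basis H.
      x p * \<chi> (m * (s - r)) * bvec p (E ((r - n) mod K) ((s - n) mod K)))"
    using assms by (simp add: comult_apply comult_basis_DE mult_ac cong: sum.cong)
  then show "comult H x (D m n, E r s) = \<chi> (m * (s - r)) * x (E ((r - n) mod K) ((s - n) mod K))"
    by (simp add: sum_bvec)
  have "comult H x (E m n, D r s) = (\<Sum>p\<in>basis H.
      x p * \<chi> (r * (n - m)) * bvec p (E ((m + s) mod K) ((n + s) mod K)))"
    using assms by (simp add: comult_apply comult_basis_ED mult_ac cong: sum.cong)
  then show "comult H x (E m n, D r s) = \<chi> (r * (n - m)) * x (E ((m + s) mod K) ((n + s) mod K))"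
    by (simp add: sum_bvec)
  \<comment> \<open>For fixed \<open>i\<close> the only candidate is \<open>j = r - m\<close> modulo
    \<open>K\<close>, and it contributes exactly when it also equals \<open>s - n\<close>.\<close>
  have "(\<Sum>j\<in>R. \<chi> (i * (m - n)) / k * x (D i j) * of_bool (r = (m + j) mod K \<and> s = (n + j) mod K))
      = \<chi> (i * (m - n)) / k * x (D i ((r - m) mod K)) * of_bool (K dvd (r - m) - (s - n))" for i
  proof (cases "K dvd (r - m) - (s - n)")
    case True
    then have eq: "(r - m) mod K = (s - n) mod K"
      by (simp add: mod_eq_dvd_iff)
    have "r = (m + j) mod K \<and> s = (n + j) mod K \<longleftrightarrow> j = (r - m) mod K" if "j \<in> R" for j
      using that assms eq eq_sub_mod_iff by metis
    with True show ?thesis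
      by (subst sum_of_bool_unique[where a = "(r - m) mod K"]) auto
  next
    case False
    then have "\<not> (r = (m + j) mod K \<and> s = (n + j) mod K)" if "j \<in> R" for j
      using that assms eq_sub_mod_iff by (metis mod_eq_dvd_iff)
    then show ?thesis
      using False by (intro sum.neutral[THEN trans]) auto
  qed
  then show "comult H x (E m n, E r s) =
      (\<Sum>i\<in>R. \<chi> (i * (m - n)) * x (D i ((r - m) mod K))) / k * of_bool (K dvd (r - m) - (s - n))"
    using assms by (simp add: comult_apply sum_basis comult_basis_EE mult_ac sum_distrib_left
        sum_divide_distrib sum_distrib_right del: sekine_comult.simps)
qed

lemma comult_outside: "t \<notin> basis H \<times> basis H \<Longrightarrow> comult H x t = 0"
  by (simp add: comult_apply comult_basis_outside)

section \<open>The Hopf algebra axioms\<close>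

declare sekine_comult.simps [simp del] sekine_mult.simps [simp del] sekine_antipode.simps [simp del]

lemma hspace_iff: "x \<in> hspace H \<longleftrightarrow> (\<forall>b. b \<notin> basis H \<longrightarrow> x b = 0)"
  by (simp add: hspace_def)

lemma mult_closed_sekine: "mult H x y \<in> hspace H"
  by (simp add: hspace_iff mult_outside)

lemma hspace_eqI:
  assumes "x \<in> hspace H" "y \<in> hspace H" "\<And>i j. i \<in> R \<Longrightarrow> j \<in> R \<Longrightarrow> x (D i j) = y (D i j)"
    and "\<And>i j. i \<in> R \<Longrightarrow> j \<in> R \<Longrightarrow> x (E i j) = y (E i j)"
  shows "x = y"
proof
  fix a show "x a = y a"
    using assms by (cases a; cases "a \<in> basis H") (auto simp: hspace_iff)
qed

lemma bvec_closed [simp]: "p \<in> basis H \<Longrightarrow> bvec p \<in> hspace H"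
  by (auto simp: hspace_iff bvec_def)

lemma unity_closed_sekine: "sekine_unity k \<in> hspace H"
  by (simp add: hspace_iff unity_outside)

section \<open>Associativity, unit and multiplicativity of the coproduct\<close>

lemma mult_assoc_sekine: "mult H (mult H x y) z = mult H x (mult H y z)"
proof (rule hspace_eqI[OF mult_closed_sekine mult_closed_sekine])
  fix i j assume ij: "i \<in> R" "j \<in> R"
  then show "mult H (mult H x y) z (D i j) = mult H x (mult H y z) (D i j)"
    by (simp add: mult_coord)
  have "mult H (mult H x y) z (E i j) = (\<Sum>t\<in>R. \<Sum>u\<in>R. x (E i u) * y (E u t) * z (E t j))"
    using ij by (simp add: mult_coord sum_distrib_right)
  also have "\<dots> = (\<Sum>u\<in>R. \<Sum>t\<in>R. x (E i u) * y (E u t) * z (E t j))"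
    by (rule sum.swap)
  also have "\<dots> = mult H x (mult H y z) (E i j)"
    using ij by (simp add: mult_coord sum_distrib_left mult.assoc)
  finally show "mult H (mult H x y) z (E i j) = mult H x (mult H y z) (E i j)" .
qed

lemma mult_unity_sekine:
  assumes "x \<in> hspace H"
  shows "mult H (sekine_unity k) x = x" "mult H x (sekine_unity k) = x"
proof -
  show "mult H (sekine_unity k) x = x"
  proof (rule hspace_eqI[OF mult_closed_sekine assms])
    fix i j assume ij: "i \<in> R" "j \<in> R"
    then show "mult H (sekine_unity k) x (D i j) = x (D i j)"
      by (simp add: mult_coord unity_coord)
    have "(\<Sum>t\<in>R. x (E t j) * of_bool (i = t)) = x (E i j)"
      by (intro sum_of_bool_unique) (use ij in auto)
    then show "mult H (sekine_unity k) x (E i j) = x (E i j)"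
      using ij by (simp add: mult_coord unity_coord mult.commute)
  qed
  show "mult H x (sekine_unity k) = x"
  proof (rule hspace_eqI[OF mult_closed_sekine assms])
    fix i j assume ij: "i \<in> R" "j \<in> R"
    then show "mult H x (sekine_unity k) (D i j) = x (D i j)"
      by (simp add: mult_coord unity_coord)
    have "(\<Sum>t\<in>R. x (E i t) * of_bool (t = j)) = x (E i j)"
      by (intro sum_of_bool_unique) (use ij in auto)
    then show "mult H x (sekine_unity k) (E i j) = x (E i j)"
      using ij by (simp add: mult_coord unity_coord)
  qed
qed

text \<open>The factor \<open>bvec q c\<close> selects \<open>q = c\<close>, so coassociativity
  becomes a statement about applying \<Delta> to a slice of the coefficient array of
  \<Delta>(x).\<close>

lemma sweedler_comult_left:
  "sweedler H (\<lambda>u v (p, q, r). (comult H u \<otimes> v) ((p, q), r)) x (a, b, c)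
    = comult H (\<lambda>p. comult H x (p, c)) (a, b)"
proof (cases "c \<in> basis H")
  case True
  have "sweedler H (\<lambda>u v (p, q, r). (comult H u \<otimes> v) ((p, q), r)) x (a, b, c)
    = (\<Sum>p\<in>basis H. \<Sum>q\<in>basis H. (comult H x (p, q) * comult_basis H p (a, b)) * bvec q c)"
    by (simp add: sweedler_apply comult_bvec mult.assoc del: sekine_sel)
  also have "\<dots> = comult H (\<lambda>p. comult H x (p, c)) (a, b)"
    using True by (simp add: sum_bvec comult_apply[of _ _ "(a, b)"] del: sekine_sel)
  finally show ?thesis .
next
  case False
  then have "bvec q c = 0" if "q \<in> basis H" for q
    using that by (auto simp: bvec_def)
  moreover have "comult H (\<lambda>p. comult H x (p, c)) (a, b) = 0"
    using False by (simp add: comult_apply[of _ _ "(a, b)"] comult_outside)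
  ultimately show ?thesis
    by (simp add: sweedler_apply)
qed

lemma sweedler_comult_right:
  "sweedler H (\<lambda>u v. u \<otimes> comult H v) x (a, b, c) = comult H (\<lambda>q. comult H x (a, q)) (b, c)"
proof (cases "a \<in> basis H")
  case True
  have "sweedler H (\<lambda>u v. u \<otimes> comult H v) x (a, b, c)
    = (\<Sum>q\<in>basis H. \<Sum>p\<in>basis H. (comult H x (p, q) * comult_basis H q (b, c)) * bvec p a)"
    by (subst sum.swap) (simp add: sweedler_apply comult_bvec mult_ac del: sekine_sel)
  also have "\<dots> = comult H (\<lambda>q. comult H x (a, q)) (b, c)"
    using True by (simp add: sum_bvec comult_apply[of _ _ "(b, c)"] del: sekine_sel)
  finally show ?thesis .
next
  case False
  then have "bvec q a = 0" if "q \<in> basis H" for q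
    using that by (auto simp: bvec_def)
  moreover have "comult H (\<lambda>q. comult H x (a, q)) (b, c) = 0"
    using False by (simp add: comult_apply[of _ _ "(b, c)"] comult_outside)
  ultimately show ?thesis
    by (simp add: sweedler_apply)
qed

text \<open>Fourier inversion: two elements of \<open>R\<close> are congruent only if equal, so
  orthogonality leaves the single term \<open>i = j\<close>.\<close>

lemma sum_\<chi>_delta:
  fixes f :: "int \<Rightarrow> complex"
  assumes "j \<in> R"
  shows "(\<Sum>i\<in>R. f i * (\<Sum>t\<in>R. \<chi> (t * (j - i)))) = k * f j"
proof -
  have "(\<Sum>i\<in>R. f i * (\<Sum>t\<in>R. \<chi> (t * (j - i)))) = (\<Sum>i\<in>R. (k * f i) * of_bool (i = j))"
  proof (intro sum.cong refl)
    fix i assume "i \<in> R"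
    then have "K dvd j - i \<longleftrightarrow> i = j"
      using assms R_mod by (auto simp flip: mod_eq_dvd_iff)
    then show "f i * (\<Sum>t\<in>R. \<chi> (t * (j - i))) = (k * f i) * of_bool (i = j)"
      by (simp add: sum_\<chi>)
  qed
  then show ?thesis
    using assms by (simp add: sum_of_bool_unique)
qed

text \<open>The phases in the blocks DE and ED are those of conjugation by a diagonal matrix; the
  intermediate index of a matrix product cancels from them.\<close>

lemma \<chi>_telescope:
  "\<chi> (a * (t - b)) * (\<chi> (a * (c - t)) * z) = \<chi> (a * (c - b)) * z"
  "\<chi> (a * (c - t)) * (\<chi> (a * (t - b)) * z) = \<chi> (a * (c - b)) * z"
  by (simp_all add: algebra_simps flip: mult.assoc[where 'a = complex] \<chi>_add)

lemma comult_mult_sekine: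
  "comult H (mult H x y) = sweedler H (\<lambda>x\<^sub>1 x\<^sub>2. sweedler H (\<lambda>y\<^sub>1 y\<^sub>2. mult H x\<^sub>1 y\<^sub>1 \<otimes> mult H x\<^sub>2 y\<^sub>2) y) x"
proof
  fix ab :: "sekine_index \<times> sekine_index"
  obtain a b where ab: "ab = (a, b)" by fastforce
  let ?rhs = "sweedler H (\<lambda>x\<^sub>1 x\<^sub>2. sweedler H (\<lambda>y\<^sub>1 y\<^sub>2. mult H x\<^sub>1 y\<^sub>1 \<otimes> mult H x\<^sub>2 y\<^sub>2) y) x"
  show "comult H (mult H x y) ab = ?rhs ab"
  proof (cases "a \<in> basis H \<and> b \<in> basis H")
    case False
    then show ?thesis
      by (auto simp: ab comult_outside sweedler_apply mult_outside)
  next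
    case basis: True
    \<comment> \<open>At a fixed coordinate both product factors are sums of indicator products, so
      the four sums over the basis collapse to the factorisations of \<open>a\<close> and
      \<open>b\<close>.\<close>
    have rhs: "?rhs ab = (\<Sum>t\<in>ltrange a. \<Sum>u\<in>ltrange b.
        comult H x (lfactor a t, lfactor b u) * comult H y (rfactor a t, rfactor b u))"
      unfolding ab sweedler_apply tensor_apply
      using basis by (simp add: mult_coord) (intro sum4_bvec[where X = "\<lambda>p q. comult H x (p, q)" and Y = "\<lambda>p q. comult H y (p, q)"]; auto)
    show ?thesis
    proof (cases a; cases b)
      fix m n r s assume "a = D m n" "b = D r s"
      then show ?thesis
        using basis rhs by (simp add: ab comult_coord mult_coord)
    next
      fix m n r s assume [simp]: "a = D m n" "b = E r s"
      have "comult H (mult H x y) ab = \<chi> (m * (s - r)) *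
          (\<Sum>t\<in>R. x (E ((r - n) mod K) t) * y (E t ((s - n) mod K)))"
        using basis by (simp add: ab comult_coord mult_coord)
      \<comment> \<open>The summation index is translated by \<open>- n\<close> because in this
        block \<Delta> translates both matrix indices, including the intermediate one.\<close>
      also have "\<dots> = \<chi> (m * (s - r)) *
          (\<Sum>t\<in>R. x (E ((r - n) mod K) ((t + (- n)) mod K)) * y (E ((t + (- n)) mod K) ((s - n) mod K)))"
        by (subst sum_shift[where f = "\<lambda>t. x (E ((r - n) mod K) t) * y (E t ((s - n) mod K))"]) simp
      also have "\<dots> = ?rhs ab"
        using basis by (simp add: rhs comult_coord sum_distrib_left \<chi>_telescope mult_ac)
      finally show ?thesis .
    next
      fix m n r s assume [simp]: "a = E m n" "b = D r s"
      have "comult H (mult H x y) ab = \<chi> (r * (n - m)) *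
          (\<Sum>t\<in>R. x (E ((m + s) mod K) t) * y (E t ((n + s) mod K)))"
        using basis by (simp add: ab comult_coord mult_coord)
      also have "\<dots> = \<chi> (r * (n - m)) *
          (\<Sum>t\<in>R. x (E ((m + s) mod K) ((t + s) mod K)) * y (E ((t + s) mod K) ((n + s) mod K)))"
        by (subst sum_shift[where f = "\<lambda>t. x (E ((m + s) mod K) t) * y (E t ((n + s) mod K))"]) simp
      also have "\<dots> = ?rhs ab"
        using basis by (simp add: rhs comult_coord sum_distrib_left \<chi>_telescope mult_ac)
      finally show ?thesis .
    next
      fix m n r s assume [simp]: "a = E m n" "b = E r s"
      let ?c = "of_bool (K dvd (r - m) - (s - n)) :: complex"
      let ?X = "\<lambda>i. x (D i ((r - m) mod K))" and ?Y = "\<lambda>i. y (D i ((r - m) mod K))"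
      have mnrs: "m \<in> R" "n \<in> R" "r \<in> R" "s \<in> R"
        using basis by auto
      \<comment> \<open>For fixed \<open>t\<close> the support condition on \<open>x\<close>
        determines \<open>u\<close> as \<open>t\<close> shifted by \<open>r - m\<close>; the
        condition on \<open>y\<close> then no longer depends on \<open>t\<close>.\<close>
      have collapse: "(\<Sum>u\<in>R. comult H x (E m t, E r u) * comult H y (E t n, E u s))
          = (\<Sum>i\<in>R. \<Sum>i'\<in>R. ?X i * ?Y i' * \<chi> (i * m - i' * n) * \<chi> (t * (i' - i))) / (k * k) * ?c"
        if t: "t \<in> R" for t
      proof -
        define u where "u = (t + (r - m)) mod K"
        have u: "u \<in> R"
          by (simp add: u_def)
        have iff: "K dvd (r - m) - (u' - t) \<longleftrightarrow> u' = u" if "u' \<in> R" for u'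
        proof -
          have "K dvd (r - m) - (u' - t) \<longleftrightarrow> (t + (r - m)) mod K = u' mod K"
            by (simp add: mod_eq_dvd_iff algebra_simps)
          then show ?thesis
            using that by (auto simp: R_mod u_def)
        qed
        have ut: "(u - t) mod K = (r - m) mod K"
          by (simp add: u_def mod_simps)
        have "K dvd (u - t) - (s - n) \<longleftrightarrow> K dvd (r - m) - (s - n)"
          by (simp add: ut flip: mod_eq_dvd_iff)
        moreover have "(\<Sum>u\<in>R. comult H x (E m t, E r u) * comult H y (E t n, E u s))
          = (\<Sum>u'\<in>R. ((\<Sum>i\<in>R. \<chi> (i * (m - t)) * ?X i) / k *
              comult H y (E t n, E u' s)) * of_bool (u' = u))"
          using mnrs t iff by (intro sum.cong refl) (simp add: comult_coord[of m t r])
        moreover have "(\<Sum>u'\<in>R. ((\<Sum>i\<in>R. \<chi> (i * (m - t)) * ?X i) / k *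
              comult H y (E t n, E u' s)) * of_bool (u' = u))
          = (\<Sum>i\<in>R. \<chi> (i * (m - t)) * ?X i) / k * comult H y (E t n, E u s)"
          by (intro sum_of_bool_unique) (use u in auto)
        ultimately have "(\<Sum>u\<in>R. comult H x (E m t, E r u) * comult H y (E t n, E u s))
          = (\<Sum>i\<in>R. \<chi> (i * (m - t)) * ?X i) * (\<Sum>i\<in>R. \<chi> (i * (t - n)) * ?Y i) / (k * k) * ?c"
          using mnrs t u ut by (simp add: comult_coord[of t n u s])
        also have "(\<Sum>i\<in>R. \<chi> (i * (m - t)) * ?X i) * (\<Sum>i\<in>R. \<chi> (i * (t - n)) * ?Y i)
          = (\<Sum>i\<in>R. \<Sum>i'\<in>R. ?X i * ?Y i' * \<chi> (i * m - i' * n) * \<chi> (t * (i' - i)))"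
          unfolding sum_product
        proof (intro sum.cong refl)
          fix i i'
          have "\<chi> (i * (m - t)) * \<chi> (i' * (t - n)) = \<chi> (i * m - i' * n) * \<chi> (t * (i' - i))"
            by (simp add: algebra_simps flip: \<chi>_add)
          then show "\<chi> (i * (m - t)) * ?X i * (\<chi> (i' * (t - n)) * ?Y i')
            = ?X i * ?Y i' * \<chi> (i * m - i' * n) * \<chi> (t * (i' - i))"
            by (simp add: mult_ac)
        qed
        finally show ?thesis .
      qed
      \<comment> \<open>The sum over \<open>t\<close> is brought innermost: orthogonality then
        forces \<open>i = i'\<close> and yields a factor \<open>k\<close> that cancels one of the
        two denominators.\<close>
      have "(\<Sum>t\<in>R. \<Sum>i\<in>R. \<Sum>i'\<in>R. ?X i * ?Y i' * \<chi> (i * m - i' * n) * \<chi> (t * (i' - i)))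
        = (\<Sum>i'\<in>R. \<Sum>i\<in>R. \<Sum>t\<in>R. ?X i * ?Y i' * \<chi> (i * m - i' * n) * \<chi> (t * (i' - i)))"
        by (subst sum.swap, subst (2) sum.swap, subst sum.swap) (rule refl)
      also have "\<dots> = (\<Sum>i'\<in>R. \<Sum>i\<in>R. ?X i * ?Y i' * \<chi> (i * m - i' * n) * (\<Sum>t\<in>R. \<chi> (t * (i' - i))))"
        by (simp flip: sum_distrib_left)
      also have "\<dots> = (\<Sum>i\<in>R. k * (?X i * ?Y i * \<chi> (i * (m - n))))"
        by (intro sum.cong refl) (subst sum_\<chi>_delta, simp_all add: right_diff_distrib)
      finally have "?rhs ab = (\<Sum>i\<in>R. k * (?X i * ?Y i * \<chi> (i * (m - n)))) / (k * k) * ?c"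
        by (simp add: rhs collapse flip: sum_distrib_right sum_divide_distrib)
      then show ?thesis
        using mnrs k_pos
        by (simp add: ab comult_coord mult_coord mult_ac flip: sum_distrib_left)
    qed
  qed
qed

section \<open>Character averages and coassociativity\<close>

lemma \<chi>_combine: "\<chi> a * \<chi> b = \<chi> (a + b)" "\<chi> a * (\<chi> b * z) = \<chi> (a + b) * z"
  by (simp_all add: \<chi>_add)

lemma dvd_diff_mod:
  "K dvd a mod K - b - (c mod K - d) \<longleftrightarrow> K dvd a - b - (c - d)"
  "K dvd a - b mod K - (c - d mod K) \<longleftrightarrow> K dvd a - b - (c - d)"
  by (simp_all add: mod_simps flip: mod_eq_dvd_iff)

lemma R_dvd_diff: "i \<in> R \<Longrightarrow> j \<in> R \<Longrightarrow> K dvd i - j \<longleftrightarrow> i = j"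
  by (simp add: R_mod flip: mod_eq_dvd_iff)

lemma R_shift_inj:
  assumes "i \<in> R" "j \<in> R"
  shows "(i + c) mod K = (j + c) mod K \<longleftrightarrow> i = j" "(i - c) mod K = (j - c) mod K \<longleftrightarrow> i = j"
  using assms by (simp_all add: mod_eq_dvd_iff R_dvd_diff)

text \<open>Averaging keeps only the trivial character \<open>i = 0\<close>. In the antipode axioms
  this is how the counit coefficient \<open>x (D 0 0)\<close> emerges on the diagonal of the matrix
  block.\<close>

lemma sum_\<chi>_average:
  "(\<Sum>t\<in>R. (\<Sum>i\<in>R. \<chi> (i * (t - c)) * f i) / k) = f 0"
  "(\<Sum>t\<in>R. (\<Sum>i\<in>R. \<chi> (i * (c - t)) * f i) / k) = f 0"
proof -
  have "(\<Sum>t\<in>R. \<chi> (i * (t - c))) = k * of_bool (i = 0)"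
    "(\<Sum>t\<in>R. \<chi> (i * (c - t))) = k * of_bool (i = 0)" if "i \<in> R" for i
  proof -
    have "K dvd i \<longleftrightarrow> i = 0"
      using R_dvd_diff[OF that zero_R] by simp
    moreover have "(\<Sum>t\<in>R. \<chi> (i * (t - c))) = \<chi> (- (i * c)) * (\<Sum>t\<in>R. \<chi> (t * i))"
      "(\<Sum>t\<in>R. \<chi> (i * (c - t))) = \<chi> (i * c) * (\<Sum>t\<in>R. \<chi> (t * (- i)))"
      by (simp_all add: sum_distrib_left \<chi>_combine algebra_simps)
    ultimately show "(\<Sum>t\<in>R. \<chi> (i * (t - c))) = k * of_bool (i = 0)"
      "(\<Sum>t\<in>R. \<chi> (i * (c - t))) = k * of_bool (i = 0)"
      using sum_\<chi>[of "- i"] by (simp_all add: sum_\<chi>)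
  qed
  note inner = this
  have "(\<Sum>t\<in>R. \<Sum>i\<in>R. \<chi> (i * (t - c)) * f i) = (\<Sum>i\<in>R. (k * f i) * of_bool (i = 0))"
    by (subst sum.swap) (simp add: inner mult_ac flip: sum_distrib_left)
  moreover have "(\<Sum>t\<in>R. \<Sum>i\<in>R. \<chi> (i * (c - t)) * f i) = (\<Sum>i\<in>R. (k * f i) * of_bool (i = 0))"
    by (subst sum.swap) (simp add: inner mult_ac flip: sum_distrib_left)
  moreover have "(\<Sum>i\<in>R. (k * f i) * of_bool (i = 0)) = k * f 0"
    by (intro sum_of_bool_unique) auto
  ultimately show "(\<Sum>t\<in>R. (\<Sum>i\<in>R. \<chi> (i * (t - c)) * f i) / k) = f 0"
    "(\<Sum>t\<in>R. (\<Sum>i\<in>R. \<chi> (i * (c - t)) * f i) / k) = f 0"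
    using k_pos by (simp_all flip: sum_divide_distrib)
qed

text \<open>Support is expressed here by equal residues, a form that \<open>mod_simps\<close> can
  normalise once shifts are nested.\<close>

lemma comult_EE:
  assumes "m \<in> R" "n \<in> R" "r \<in> R" "s \<in> R"
  shows "comult H x (E m n, E r s) = (\<Sum>i\<in>R. \<chi> (i * (m - n)) * x (D i ((r - m) mod K))) / k *
    of_bool ((r - m) mod K = (s - n) mod K)"
  using assms by (simp add: comult_coord mod_eq_dvd_iff)

text \<open>The Fourier transform turns translation into multiplication by a character.\<close>

lemma sum_\<chi>_shift: "(\<Sum>i\<in>R. \<chi> (i * d) * f ((i + m) mod K)) = \<chi> (- (m * d)) * (\<Sum>i\<in>R. \<chi> (i * d) * f i)"
proof -
  have "(\<Sum>i\<in>R. \<chi> (i * d) * f ((i + m) mod K))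
      = \<chi> (- (m * d)) * (\<Sum>i\<in>R. \<chi> ((i + m) mod K * d) * f ((i + m) mod K))"
    unfolding sum_distrib_left by (intro sum.cong refl) (simp add: \<chi>_combine distrib_right)
  then show ?thesis
    by (simp only: sum_shift[where f = "\<lambda>i. \<chi> (i * d) * f i"])
qed

text \<open>With at most one \<open>E\<close> among the coordinates, indices and phases simply add.
  With two, a Fourier sum over \<open>D\<close> coefficients must absorb a translation or a phase.
  With three, both sides reduce to one \<open>E\<close> coefficient with matching support.\<close>

lemma comult_coassoc_coord:
  assumes "a \<in> basis H" "b \<in> basis H" "c \<in> basis H"
  shows "comult H (\<lambda>p. comult H x (p, c)) (a, b) = comult H (\<lambda>q. comult H x (a, q)) (b, c)"
proof (cases a; cases b; cases c)
  fix m n r s u v assume "a = D m n" "b = D r s" "c = D u v"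
  then show ?thesis
    using assms by (simp add: comult_coord mod_simps add.assoc)
next
  fix m n r s u v assume "a = D m n" "b = D r s" "c = E u v"
  then show ?thesis
    using assms by (simp add: comult_coord mod_simps \<chi>_combine) (simp add: algebra_simps)
next
  fix m n r s u v assume "a = D m n" "b = E r s" "c = D u v"
  then show ?thesis
    using assms by (simp add: comult_coord mod_simps \<chi>_combine) (simp add: algebra_simps)
next
  fix m n r s u v assume abc: "a = D m n" "b = E r s" "c = E u v"
  have "comult H (\<lambda>p. comult H x (p, c)) (a, b) = \<chi> (m * (s - r)) *
      ((\<Sum>i\<in>R. \<chi> (i * (r - s)) * x (D i ((u - (r - n)) mod K))) / k * of_bool ((u - r) mod K = (v - s) mod K))"
    using assms abc by (simp add: comult_coord(1-3) comult_EE mod_simps)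
      (simp add: mod_eq_dvd_iff algebra_simps)
  \<comment> \<open>The phase in front is exactly the price of translating the first
    \<open>D\<close> index by \<open>m\<close>.\<close>
  also have "\<dots> = (\<Sum>i\<in>R. \<chi> (i * (r - s)) * x (D ((i + m) mod K) ((u - (r - n)) mod K))) / k *
      of_bool ((u - r) mod K = (v - s) mod K)"
    by (subst sum_\<chi>_shift[where f = "\<lambda>i. x (D i ((u - (r - n)) mod K))"]) (simp add: algebra_simps)
  also have "\<dots> = comult H (\<lambda>q. comult H x (a, q)) (b, c)"
    using assms abc by (simp add: comult_coord(1-3) comult_EE mod_simps cong: sum.cong)
      (simp add: algebra_simps)
  finally show ?thesis .
next
  fix m n r s u v assume "a = E m n" "b = D r s" "c = D u v"
  then show ?thesis
    using assms by (simp add: comult_coord mod_simps \<chi>_combine) (simp add: algebra_simps)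
next
  fix m n r s u v assume abc: "a = E m n" "b = D r s" "c = E u v"
  \<comment> \<open>The two sides carry different phases, which are compared only on the support of
    the indicator; there \<open>n - m\<close> and \<open>v - u\<close> are congruent.\<close>
  have \<chi>: "\<chi> (r * (n - m)) = \<chi> (r * (v - u))" if "(u - m) mod K = (v - n) mod K"
  proof (rule \<chi>_cong)
    have "(n - m) mod K = (v - u) mod K"
      using that by (simp add: mod_eq_dvd_iff dvd_diff_commute algebra_simps)
    then show "r * (n - m) mod K = r * (v - u) mod K"
      by (metis mod_mult_right_eq)
  qed
  have "comult H (\<lambda>p. comult H x (p, c)) (a, b) = \<chi> (r * (n - m)) *
      ((\<Sum>i\<in>R. \<chi> (i * (m - n)) * x (D i ((u - m - s) mod K))) / k * of_bool ((u - m) mod K = (v - n) mod K))"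
    using assms abc by (simp add: comult_coord dvd_diff_mod mod_simps)
      (simp add: mod_eq_dvd_iff algebra_simps)
  also have "\<dots> = \<chi> (r * (v - u)) *
      ((\<Sum>i\<in>R. \<chi> (i * (m - n)) * x (D i ((u - m - s) mod K))) / k * of_bool ((u - m) mod K = (v - n) mod K))"
    using \<chi> by simp
  also have "\<dots> = comult H (\<lambda>q. comult H x (a, q)) (b, c)"
    using assms abc by (simp add: comult_coord dvd_diff_mod mod_simps cong: sum.cong)
      (simp add: mod_eq_dvd_iff algebra_simps)
  finally show ?thesis .
next
  fix m n r s u v assume abc: "a = E m n" "b = E r s" "c = D u v"
  have \<chi>: "\<chi> (- (u * (m - n))) = \<chi> (u * (s - r))" if "(r - m) mod K = (s - n) mod K"
  proof (rule \<chi>_cong)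
    have "(n - m) mod K = (s - r) mod K"
      using that by (simp add: mod_eq_dvd_iff dvd_diff_commute algebra_simps)
    then have "u * (n - m) mod K = u * (s - r) mod K"
      by (metis mod_mult_right_eq)
    then show "- (u * (m - n)) mod K = u * (s - r) mod K"
      by (simp add: algebra_simps)
  qed
  have "comult H (\<lambda>p. comult H x (p, c)) (a, b) =
      (\<Sum>i\<in>R. \<chi> (i * (m - n)) * x (D ((i + u) mod K) ((r - m + v) mod K))) / k *
      of_bool ((r - m) mod K = (s - n) mod K)"
    using assms abc by (simp add: comult_coord(1-3) comult_EE mod_simps cong: sum.cong)
  also have "\<dots> = \<chi> (u * (s - r)) * ((\<Sum>i\<in>R. \<chi> (i * (m - n)) * x (D i ((r - m + v) mod K))) / k *
      of_bool ((r - m) mod K = (s - n) mod K))"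
    using \<chi> by (subst sum_\<chi>_shift[where f = "\<lambda>i. x (D i ((r - m + v) mod K))"]) simp
  also have "\<dots> = comult H (\<lambda>q. comult H x (a, q)) (b, c)"
    using assms abc by (simp add: comult_coord dvd_diff_mod mod_simps cong: sum.cong)
      (simp add: mod_eq_dvd_iff algebra_simps)
  finally show ?thesis .
next
  fix m n r s u v assume abc: "a = E m n" "b = E r s" "c = E u v"
  \<comment> \<open>These are the supports of the two sides. They share the congruence of
    \<open>r - m\<close> with \<open>s - n\<close>, and the remaining condition on the right is
    minus the sum of the two on the left.\<close>
  have iff: "(r - m) mod K = (s - n) mod K \<and> K dvd (m - n) + (v - u) \<longleftrightarrow>
      (u - r) mod K = (v - s) mod K \<and> K dvd (n - m) + (r - s)"
  proof -
    have "(u - r) - (v - s) = - (((r - m) - (s - n)) + ((m - n) + (v - u)))"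
      "(n - m) + (r - s) = (r - m) - (s - n)"
      by simp_all
    then show ?thesis
      unfolding mod_eq_dvd_iff by (metis dvd_add_right_iff dvd_minus_iff)
  qed
  have eq: "(v - r + m) mod K = (n + (u - r)) mod K" if "K dvd (m - n) + (v - u)"
    using that by (simp add: mod_eq_dvd_iff algebra_simps)
  have "comult H (\<lambda>p. comult H x (p, c)) (a, b) =
      (\<Sum>i\<in>R. \<chi> (i * ((m - n) + (v - u))) * x (E ((u - r + m) mod K) ((v - r + m) mod K))) / k *
      of_bool ((r - m) mod K = (s - n) mod K)"
    using assms abc by (simp add: comult_coord(1-3) comult_EE mod_simps \<chi>_combine cong: sum.cong)
      (simp add: algebra_simps)
  \<comment> \<open>The coefficient does not depend on \<open>i\<close>, so the remaining pure
    character sum becomes a divisibility condition and cancels \<open>k\<close>.\<close>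
  also have "\<dots> = x (E ((u - r + m) mod K) ((v - r + m) mod K)) *
      of_bool ((r - m) mod K = (s - n) mod K \<and> K dvd (m - n) + (v - u))"
    using k_pos by (auto simp: sum_\<chi> simp flip: sum_distrib_right)
  also have "\<dots> = x (E ((m + (u - r)) mod K) ((n + (u - r)) mod K)) *
      of_bool ((u - r) mod K = (v - s) mod K \<and> K dvd (n - m) + (r - s))"
    using eq unfolding iff[symmetric] by (auto simp: add.commute)
  also have "\<dots> = (\<Sum>i\<in>R. \<chi> (i * ((n - m) + (r - s))) * x (E ((m + (u - r)) mod K) ((n + (u - r)) mod K))) / k *
      of_bool ((u - r) mod K = (v - s) mod K)"
    using k_pos by (auto simp: sum_\<chi> simp flip: sum_distrib_right)
  also have "\<dots> = comult H (\<lambda>q. comult H x (a, q)) (b, c)"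
    using assms abc by (simp add: comult_coord(1-3) comult_EE mod_simps \<chi>_combine cong: sum.cong)
      (simp add: algebra_simps)
  finally show ?thesis .
qed

lemma coassoc_sekine:
  "sweedler H (\<lambda>u v (p, q, r). (comult H u \<otimes> v) ((p, q), r)) x = sweedler H (\<lambda>u v. u \<otimes> comult H v) x"
proof
  fix abc :: "sekine_index \<times> sekine_index \<times> sekine_index"
  obtain a b c where abc: "abc = (a, b, c)"
    by (cases abc)
  have "comult H (\<lambda>p. comult H x (p, c)) (a, b) = comult H (\<lambda>q. comult H x (a, q)) (b, c)"
  proof (cases "a \<in> basis H \<and> b \<in> basis H \<and> c \<in> basis H")
    case False
    have zero: "comult H (\<lambda>p. 0) t = 0" for t
      by (simp add: comult_apply)
    from False show ?thesis
      by (auto simp: comult_outside zero)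
  next
    case True
    then show ?thesis
      by (simp add: comult_coassoc_coord)
  qed
  then show "sweedler H (\<lambda>u v (p, q, r). (comult H u \<otimes> v) ((p, q), r)) x abc
      = sweedler H (\<lambda>u v. u \<otimes> comult H v) x abc"
    by (simp only: abc sweedler_comult_left sweedler_comult_right)
qed

section \<open>Counit, unit and antipode axioms\<close>

lemma counit_bvec: "counit H (bvec p) = bvec p (D 0 0)"
  by (simp add: counit_coord)

lemma counit_axioms_sekine:
  assumes "x \<in> hspace H"
  shows "sweedler H (\<lambda>u v. counit H u *\<^sub>C v) x = x" "sweedler H (\<lambda>u v. counit H v *\<^sub>C u) x = x"
proof -
  have out: "x a = 0" "p \<in> basis H \<Longrightarrow> bvec p a = 0" if "a \<notin> basis H" for a p
    using assms that by (auto simp: hspace_iff bvec_def)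
  show "sweedler H (\<lambda>u v. counit H u *\<^sub>C v) x = x"
  proof
    fix a
    show "sweedler H (\<lambda>u v. counit H u *\<^sub>C v) x a = x a"
    proof (cases "a \<in> basis H")
      case True
      then have "sweedler H (\<lambda>u v. counit H u *\<^sub>C v) x a = comult H x (D 0 0, a)"
        by (simp add: sweedler_apply counit_bvec sum_bvec2)
      also have "\<dots> = x a"
        using True by (cases a) (simp_all add: comult_coord R_mod)
      finally show ?thesis .
    qed (simp add: sweedler_apply out)
  qed
  show "sweedler H (\<lambda>u v. counit H v *\<^sub>C u) x = x"
  proof
    fix a
    show "sweedler H (\<lambda>u v. counit H v *\<^sub>C u) x a = x a"
    proof (cases "a \<in> basis H")
      case True
      have "sweedler H (\<lambda>u v. counit H v *\<^sub>C u) x a =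
          (\<Sum>p\<in>basis H. \<Sum>q\<in>basis H. comult H x (p, q) * (bvec p a * bvec q (D 0 0)))"
        by (simp add: sweedler_apply counit_bvec mult.commute)
      also have "\<dots> = comult H x (a, D 0 0)"
        using True by (simp add: sum_bvec2)
      also have "\<dots> = x a"
        using True by (cases a) (simp_all add: comult_coord R_mod)
      finally show ?thesis .
    qed (simp add: sweedler_apply out)
  qed
qed

lemma comult_unity_sekine: "comult H (sekine_unity k) = sekine_unity k \<otimes> sekine_unity k"
proof
  fix t :: "sekine_index \<times> sekine_index"
  obtain a b where t: "t = (a, b)" by fastforce
  show "comult H (sekine_unity k) t = (sekine_unity k \<otimes> sekine_unity k) t"
  proof (cases "a \<in> basis H \<and> b \<in> basis H")
    case False
    then show ?thesis
      by (auto simp: t comult_outside unity_outside)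
  next
    case True
    then show ?thesis
      using k_pos by (cases a; cases b)
        (auto simp: t comult_coord unity_coord sum_\<chi> R_shift_inj R_dvd_diff)
  qed
qed

text \<open>At a \<open>D\<close> coordinate the two indices of \<Delta>(x) add up to zero. At
  \<open>E i j\<close> the support condition forces \<open>i = j\<close>, and the sum over the
  intermediate index is a character average.\<close>

lemma antipode_axioms_sekine:
  "sweedler H (\<lambda>u v. mult H (antipode H u) v) x = counit H x *\<^sub>C sekine_unity k"
  "sweedler H (\<lambda>u v. mult H u (antipode H v)) x = counit H x *\<^sub>C sekine_unity k"
proof -
  have "sweedler H (\<lambda>u v. mult H (antipode H u) v) x a =
      (\<Sum>t\<in>ltrange a. comult H x (neg_index (lfactor a t), rfactor a t))" if a: "a \<in> basis H" for a
  proof -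
    have "sweedler H (\<lambda>u v. mult H (antipode H u) v) x a = (\<Sum>p\<in>basis H. \<Sum>q\<in>basis H. comult H x (p, q) *
       (\<Sum>t\<in>ltrange a. bvec p (neg_index (lfactor a t)) * bvec q (rfactor a t)))"
      using a by (simp add: sweedler_apply mult_coord antipode_coord)
    also have "\<dots> = (\<Sum>t\<in>ltrange a. comult H x (neg_index (lfactor a t), rfactor a t))"
      using a by (intro sum_bvec2_sum) auto
    finally show ?thesis .
  qed
  note left = this
  show "sweedler H (\<lambda>u v. mult H (antipode H u) v) x = counit H x *\<^sub>C sekine_unity k"
  proof
    fix a show "sweedler H (\<lambda>u v. mult H (antipode H u) v) x a = (counit H x *\<^sub>C sekine_unity k) a"
    proof (cases "a \<in> basis H")
      case True
      then show ?thesis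
        by (cases a) (auto simp: left counit_coord comult_coord unity_coord mod_simps R_dvd_diff sum_\<chi>_average)
    qed (simp add: sweedler_apply mult_outside unity_outside)
  qed
  have "sweedler H (\<lambda>u v. mult H u (antipode H v)) x a =
      (\<Sum>t\<in>ltrange a. comult H x (lfactor a t, neg_index (rfactor a t)))" if a: "a \<in> basis H" for a
  proof -
    have "sweedler H (\<lambda>u v. mult H u (antipode H v)) x a = (\<Sum>p\<in>basis H. \<Sum>q\<in>basis H. comult H x (p, q) *
       (\<Sum>t\<in>ltrange a. bvec p (lfactor a t) * bvec q (neg_index (rfactor a t))))"
      using a by (simp add: sweedler_apply mult_coord antipode_coord)
    also have "\<dots> = (\<Sum>t\<in>ltrange a. comult H x (lfactor a t, neg_index (rfactor a t)))"
      using a by (intro sum_bvec2_sum) auto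
    finally show ?thesis .
  qed
  note right = this
  show "sweedler H (\<lambda>u v. mult H u (antipode H v)) x = counit H x *\<^sub>C sekine_unity k"
  proof
    fix a show "sweedler H (\<lambda>u v. mult H u (antipode H v)) x a = (counit H x *\<^sub>C sekine_unity k) a"
    proof (cases "a \<in> basis H")
      case True
      then show ?thesis
        by (cases a) (auto simp: right counit_coord comult_coord unity_coord mod_simps R_dvd_diff sum_\<chi>_average)
    qed (simp add: sweedler_apply mult_outside unity_outside)
  qed
qed

lemma hopf_algebra_sekine: "hopf_algebra H"
proof
  show "p \<in> basis H \<Longrightarrow> q \<in> basis H \<Longrightarrow> mult_basis H p q \<in> hspace H" for p q
    by (cases p; cases q) (auto simp: sekine_mult.simps hspace_iff bvec_def)
  show "p \<in> basis H \<Longrightarrow> antipode_basis H p \<in> hspace H" for p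
    by (cases p) (auto simp: sekine_antipode.simps hspace_iff bvec_def)
\<comment> \<open>\<open>simp only\<close> keeps the Sweedler integrands in the shape of these
  lemmas; rules such as \<open>tensor_apply\<close> and \<open>counit_coord\<close> would rewrite
  inside them.\<close>
qed (simp only: coassoc_sekine counit_axioms_sekine | simp add: comult_basis_outside unity_closed_sekine mult_assoc_sekine
    mult_unity_sekine comult_mult_sekine comult_unity_sekine antipode_axioms_sekine counit_coord mult_coord unity_coord)+

sublocale hopf_algebra H
  by (rule hopf_algebra_sekine)

section \<open>Semisimplicity\<close>

lemma mult_bvec:
  assumes "i \<in> R" "j \<in> R"
  shows "mult H (bvec (D i j)) x = x (D i j) *\<^sub>C bvec (D i j)"
    and "mult H x (bvec (D i j)) = x (D i j) *\<^sub>C bvec (D i j)"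
    and "mult H (bvec (E i j)) x = (\<Sum>t\<in>R. x (E j t) *\<^sub>C bvec (E i t))"
    and "mult H x (bvec (E i j)) = (\<Sum>t\<in>R. x (E t i) *\<^sub>C bvec (E t j))"
proof -
  have closed: "(\<Sum>t\<in>R. c t *\<^sub>C bvec (E i t)) \<in> hspace H"
    "(\<Sum>t\<in>R. c t *\<^sub>C bvec (E t j)) \<in> hspace H" "c 0 *\<^sub>C bvec (D i j) \<in> hspace H" for c
    using assms by (auto intro!: cfun.subspace_sum cfun.subspace_scale subspace_hspace)
  show "mult H (bvec (D i j)) x = x (D i j) *\<^sub>C bvec (D i j)"
    using assms by (intro hspace_eqI mult_closed cfun.subspace_scale subspace_hspace)
      (auto simp: mult_coord bvec_of_bool)
  show "mult H x (bvec (D i j)) = x (D i j) *\<^sub>C bvec (D i j)"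
    using assms by (intro hspace_eqI mult_closed cfun.subspace_scale subspace_hspace)
      (auto simp: mult_coord bvec_of_bool)
  show "mult H (bvec (E i j)) x = (\<Sum>t\<in>R. x (E j t) *\<^sub>C bvec (E i t))"
  proof (rule hspace_eqI[OF mult_closed closed(1)])
    fix m n assume mn: "m \<in> R" "n \<in> R"
    show "mult H (bvec (E i j)) x (D m n) = (\<Sum>t\<in>R. x (E j t) *\<^sub>C bvec (E i t)) (D m n)"
      using mn by (simp add: mult_coord sum_fun_eval bvec_of_bool)
    have "(\<Sum>t\<in>R. x (E t n) * of_bool (t = j)) = x (E j n)"
      "(\<Sum>t\<in>R. x (E j t) * of_bool (n = t)) = x (E j n)"
      by (intro sum_of_bool_unique; use assms mn in auto)+
    then have "(\<Sum>t\<in>R. x (E t n) * of_bool (m = i \<and> t = j)) = (\<Sum>t\<in>R. x (E j t) * of_bool (m = i \<and> n = t))"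
      by (cases "m = i") simp_all
    then show "mult H (bvec (E i j)) x (E m n) = (\<Sum>t\<in>R. x (E j t) *\<^sub>C bvec (E i t)) (E m n)"
      using mn by (simp add: mult_coord sum_fun_eval bvec_of_bool mult_ac)
  qed
  show "mult H x (bvec (E i j)) = (\<Sum>t\<in>R. x (E t i) *\<^sub>C bvec (E t j))"
  proof (rule hspace_eqI[OF mult_closed closed(2)])
    fix m n assume mn: "m \<in> R" "n \<in> R"
    show "mult H x (bvec (E i j)) (D m n) = (\<Sum>t\<in>R. x (E t i) *\<^sub>C bvec (E t j)) (D m n)"
      using mn by (simp add: mult_coord sum_fun_eval bvec_of_bool)
    have "(\<Sum>t\<in>R. x (E m t) * of_bool (t = i)) = x (E m i)"
      "(\<Sum>t\<in>R. x (E t i) * of_bool (m = t)) = x (E m i)"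
      by (intro sum_of_bool_unique; use assms mn in auto)+
    then have "(\<Sum>t\<in>R. x (E m t) * of_bool (t = i \<and> n = j)) = (\<Sum>t\<in>R. x (E t i) * of_bool (m = t \<and> n = j))"
      by (cases "n = j") simp_all
    then show "mult H x (bvec (E i j)) (E m n) = (\<Sum>t\<in>R. x (E t i) *\<^sub>C bvec (E t j)) (E m n)"
      using mn by (simp add: mult_coord sum_fun_eval bvec_of_bool mult_ac)
  qed
qed

lemma left_ideal_complemented_sekine:
  assumes "left_ideal H I"
  shows "\<exists>J. left_ideal H J \<and> I \<inter> J = {0} \<and> {x + y |x y. x \<in> I \<and> y \<in> J} = hspace H"
proof -
  have I: "I \<subseteq> hspace H" "cfun.subspace I" "\<And>a x. a \<in> hspace H \<Longrightarrow> x \<in> I \<Longrightarrow> mult H a x \<in> I"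
    using assms by (auto simp: left_ideal_def)
  \<comment> \<open>A linear projection onto \<open>I\<close>, obtained as a linear left inverse of
    the inclusion, which is \<open>id\<close> on \<open>I\<close>.\<close>
  have "\<exists>g. g ` UNIV \<subseteq> I \<and> Vector_Spaces.linear cscale cscale g \<and> (\<forall>v\<in>I. g (id v) = v)"
    using I(2) by (intro vector_space_pair.linear_exists_left_inverse_on cfun.linear_id
        vector_space_pair.intro cfun.vector_space_axioms) auto
  then obtain \<pi> where range: "\<And>x. \<pi> x \<in> I" and lin: "Vector_Spaces.linear cscale cscale \<pi>"
    and proj: "\<And>v. v \<in> I \<Longrightarrow> \<pi> v = v"
    by auto
  interpret \<pi>: Vector_Spaces.linear cscale cscale \<pi> by (rule lin)
  \<comment> \<open>Averaging the projection over the separability idempotent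
    \<open>\<Sum> d\<^sub>i\<^sub>j \<otimes> d\<^sub>i\<^sub>j + \<Sum> e\<^sub>i\<^sub>0 \<otimes> e\<^sub>0\<^sub>i\<close> makes it a module map.\<close>
  define P where "P x = (\<Sum>i\<in>R. \<Sum>j\<in>R. mult H (bvec (D i j)) (\<pi> (mult H (bvec (D i j)) x)))
    + (\<Sum>i\<in>R. mult H (bvec (E i 0)) (\<pi> (mult H (bvec (E 0 i)) x)))" for x
  have P_add: "P (x + y) = P x + P y" for x y
    by (simp add: P_def mult_add \<pi>.add sum.distrib)
  have P_scale: "P (c *\<^sub>C x) = c *\<^sub>C P x" for c x
    by (simp add: P_def mult_scale \<pi>.scale cfun.scale_sum_right cfun.scale_right_distrib)
  have P_in: "P x \<in> I" for x
    unfolding P_def using range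
    by (intro cfun.subspace_add cfun.subspace_sum I) auto
  have P_id: "P x = x" if x: "x \<in> I" for x
  proof -
    have "mult H (bvec p) x \<in> I" if "p \<in> basis H" for p
      using that x I by simp
    then have "P x = (\<Sum>i\<in>R. \<Sum>j\<in>R. mult H (mult H (bvec (D i j)) (bvec (D i j))) x)
        + (\<Sum>i\<in>R. mult H (mult H (bvec (E i 0)) (bvec (E 0 i))) x)"
      by (simp add: P_def proj mult_assoc_sekine)
    \<comment> \<open>Multiplying the two legs of the separability idempotent gives the
      unit.\<close>
    also have "\<dots> = mult H (sekine_unity k) x"
    proof -
      have "mult H (bvec (E i 0)) (bvec (E 0 i)) = bvec (E i i)" if "i \<in> R" for i
      proof
        fix a
        have "(\<Sum>t\<in>R. bvec (E i t) a * of_bool (t = i)) = bvec (E i i) a"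
          using that by (intro sum_of_bool_unique) auto
        then show "mult H (bvec (E i 0)) (bvec (E 0 i)) a = bvec (E i i) a"
          using that by (simp add: mult_bvec(3) sum_fun_eval bvec_of_bool mult.commute)
      qed
      moreover have "mult H (bvec (D i j)) (bvec (D i j)) = bvec (D i j)" if "i \<in> R" "j \<in> R" for i j
        using that by (simp add: mult_bvec bvec_of_bool)
      ultimately show ?thesis
        by (simp add: sekine_unity_def mult_add mult_sum)
    qed
    also have "\<dots> = x"
      using x I by (intro mult_unity_sekine) auto
    finally show ?thesis .
  qed
  \<comment> \<open>Moving \<open>a\<close> from the right leg of the idempotent to the left leg
    does not change it: on the matrix block both give the sum of \<open>a (E i t)\<close> times e_i0
    \<otimes> e_0t.\<close>
  have P_hom: "P (mult H a x) = mult H a (P x)" for a x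
  proof -
    have "P (mult H a x) = (\<Sum>i\<in>R. \<Sum>j\<in>R. a (D i j) *\<^sub>C mult H (bvec (D i j)) (\<pi> (mult H (bvec (D i j)) x)))
      + (\<Sum>i\<in>R. \<Sum>t\<in>R. a (E i t) *\<^sub>C mult H (bvec (E i 0)) (\<pi> (mult H (bvec (E 0 t)) x)))"
      unfolding P_def mult_assoc_sekine[symmetric]
      by (simp add: mult_bvec(1,3)[where x = a] mult_scale mult_sum \<pi>.scale \<pi>.sum)
    also have "(\<Sum>i\<in>R. \<Sum>t\<in>R. a (E i t) *\<^sub>C mult H (bvec (E i 0)) (\<pi> (mult H (bvec (E 0 t)) x)))
      = (\<Sum>t\<in>R. \<Sum>i\<in>R. a (E i t) *\<^sub>C mult H (bvec (E i 0)) (\<pi> (mult H (bvec (E 0 t)) x)))"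
      by (rule sum.swap)
    also have "(\<Sum>i\<in>R. \<Sum>j\<in>R. a (D i j) *\<^sub>C mult H (bvec (D i j)) (\<pi> (mult H (bvec (D i j)) x))) + \<dots>
      = mult H a (P x)"
      unfolding P_def mult_add mult_sum mult_assoc_sekine[symmetric]
      by (simp add: mult_bvec(2,4)[where x = a] mult_scale mult_sum)
    finally show ?thesis .
  qed
  \<comment> \<open>\<open>P\<close> is a module endomorphism with values in \<open>I\<close> and is
    the identity on \<open>I\<close>, so its kernel is a complementary left ideal.\<close>
  define J where "J = {x \<in> hspace H. P x = 0}"
  have P0: "P 0 = 0"
    using P_scale[of 0 0] by simp
  have "left_ideal H J"
    using P_add P_scale P_hom P0 subspace_hspace[of H]
    by (auto simp: left_ideal_def J_def cfun.subspace_def mult_closed)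
  moreover have "I \<inter> J = {0}"
    using P_id P0 I cfun.subspace_0[OF I(2)] by (auto simp: J_def)
  moreover have "\<exists>y z. x = y + z \<and> y \<in> I \<and> z \<in> J" if x: "x \<in> hspace H" for x
  proof (intro exI conjI)
    show "x = P x + (x - P x)" "P x \<in> I"
      by (simp_all add: P_in)
    have "P (x - P x) + P (P x) = P x"
      by (simp flip: P_add)
    then have "P (x - P x) = 0"
      using P_id[OF P_in] by simp
    then show "x - P x \<in> J"
      using x P_in I by (auto simp: J_def intro!: cfun.subspace_diff subspace_hspace)
  qed
  then have "{x + y |x y. x \<in> I \<and> y \<in> J} = hspace H"
    using I by (auto simp: J_def intro!: cfun.subspace_add subspace_hspace)
  ultimately show ?thesis by blast
qed

lemma semisimple_sekine: "semisimple_hopf_algebra H"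
  by unfold_locales (rule left_ideal_complemented_sekine)

section \<open>The chain of left coideal subalgebras\<close>

text \<open>This is \<open>\<alpha> e\<^sub>D + \<beta> e\<^sub>M\<close>, given by coefficients so
  that it can be compared coordinatewise.\<close>

fun block_scalar :: "complex \<Rightarrow> complex \<Rightarrow> sekine_index \<Rightarrow> complex" where
  "block_scalar \<alpha> \<beta> (D i j) = (if i \<in> R \<and> j \<in> R then \<alpha> else 0)"
| "block_scalar \<alpha> \<beta> (E i j) = (if i \<in> R \<and> j \<in> R \<and> i = j then \<beta> else 0)"

abbreviation "block_scalars \<equiv> {block_scalar \<alpha> \<beta> |\<alpha> \<beta>. True}"

lemma block_scalar_closed: "block_scalar \<alpha> \<beta> \<in> hspace H"
  unfolding hspace_iff
proof (intro allI impI)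
  fix b show "b \<notin> basis H \<Longrightarrow> block_scalar \<alpha> \<beta> b = 0"
    by (cases b) auto
qed

lemma block_scalar_linear:
  "block_scalar \<alpha> \<beta> + block_scalar \<alpha>' \<beta>' = block_scalar (\<alpha> + \<alpha>') (\<beta> + \<beta>')"
  "c *\<^sub>C block_scalar \<alpha> \<beta> = block_scalar (c * \<alpha>) (c * \<beta>)"
  "0 = block_scalar 0 0"
proof -
  show "block_scalar \<alpha> \<beta> + block_scalar \<alpha>' \<beta>' = block_scalar (\<alpha> + \<alpha>') (\<beta> + \<beta>')"
  proof
    fix a show "(block_scalar \<alpha> \<beta> + block_scalar \<alpha>' \<beta>') a = block_scalar (\<alpha> + \<alpha>') (\<beta> + \<beta>') a"
      by (cases a) auto
  qed
  show "c *\<^sub>C block_scalar \<alpha> \<beta> = block_scalar (c * \<alpha>) (c * \<beta>)"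
  proof
    fix a show "(c *\<^sub>C block_scalar \<alpha> \<beta>) a = block_scalar (c * \<alpha>) (c * \<beta>) a"
      by (cases a) auto
  qed
  show "0 = block_scalar 0 0"
  proof
    fix a show "0 a = block_scalar 0 0 a"
      by (cases a) auto
  qed
qed

lemma unity_block_scalar: "sekine_unity k = block_scalar 1 1"
  by (rule hspace_eqI) (auto simp: unity_closed_sekine block_scalar_closed unity_coord)

lemma mult_block_scalar_coord:
  assumes "i \<in> R" "j \<in> R"
  shows "mult H (block_scalar \<alpha> \<beta>) x (D i j) = \<alpha> * x (D i j)"
    "mult H x (block_scalar \<alpha> \<beta>) (D i j) = \<alpha> * x (D i j)"
    "mult H (block_scalar \<alpha> \<beta>) x (E i j) = \<beta> * x (E i j)"
    "mult H x (block_scalar \<alpha> \<beta>) (E i j) = \<beta> * x (E i j)"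
proof -
  show "mult H (block_scalar \<alpha> \<beta>) x (D i j) = \<alpha> * x (D i j)"
    "mult H x (block_scalar \<alpha> \<beta>) (D i j) = \<alpha> * x (D i j)"
    using assms by (simp_all add: mult_coord)
  have "mult H (block_scalar \<alpha> \<beta>) x (E i j) = (\<Sum>t\<in>R. \<beta> * x (E t j) * of_bool (t = i))"
    using assms by (simp add: mult_coord) (intro sum.cong, auto)
  also have "\<dots> = \<beta> * x (E i j)"
    using assms by (intro sum_of_bool_unique) auto
  finally show "mult H (block_scalar \<alpha> \<beta>) x (E i j) = \<beta> * x (E i j)" .
  have "mult H x (block_scalar \<alpha> \<beta>) (E i j) = (\<Sum>t\<in>R. \<beta> * x (E i t) * of_bool (t = j))"
    using assms by (simp add: mult_coord) (intro sum.cong, auto)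
  also have "\<dots> = \<beta> * x (E i j)"
    using assms by (intro sum_of_bool_unique) auto
  finally show "mult H x (block_scalar \<alpha> \<beta>) (E i j) = \<beta> * x (E i j)" .
qed

lemma block_scalar_central: "block_scalar \<alpha> \<beta> \<in> center H (hspace H)"
  by (auto simp: center_def block_scalar_closed mult_block_scalar_coord intro!: hspace_eqI mult_closed)

text \<open>For functions on the group of order two, \<Delta>(f) is the sum over h of the translate
  of f by h, tensored with the point mass at h; translation by the nontrivial element swaps \<alpha>
  and \<beta>.\<close>

lemma comult_block_scalar:
  "comult H (block_scalar \<alpha> \<beta>) =
    block_scalar \<alpha> \<beta> \<otimes> block_scalar 1 0 + block_scalar \<beta> \<alpha> \<otimes> block_scalar 0 1"
proof
  fix t :: "sekine_index \<times> sekine_index"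
  obtain a b where t: "t = (a, b)" by fastforce
  show "comult H (block_scalar \<alpha> \<beta>) t =
      (block_scalar \<alpha> \<beta> \<otimes> block_scalar 1 0 + block_scalar \<beta> \<alpha> \<otimes> block_scalar 0 1) t"
  proof (cases "a \<in> basis H \<and> b \<in> basis H")
    case False
    then have "comult H (block_scalar \<alpha> \<beta>) t = 0"
      by (simp add: t comult_outside)
    with False show ?thesis
      using block_scalar_closed by (auto simp: t hspace_iff)
  next
    case True
    \<comment> \<open>In the block EE the Fourier transform of a constant is concentrated at
      frequency zero, which produces the diagonal of the matrix block.\<close>
    have "(\<Sum>i\<in>R. \<chi> (i * c) * \<alpha>) = (if K dvd c then of_nat k * \<alpha> else 0)" for c
      by (simp add: sum_\<chi> flip: sum_distrib_right)
    then show ?thesis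
      using True k_pos by (cases a; cases b)
        (auto simp: t comult_coord R_shift_inj R_dvd_diff)
  qed
qed

lemma left_coideal_subalgebra_block_scalars: "left_coideal_subalgebra H block_scalars"
proof -
  have "mult H (block_scalar \<alpha> \<beta>) (block_scalar \<alpha>' \<beta>') = block_scalar (\<alpha> * \<alpha>') (\<beta> * \<beta>')" for \<alpha> \<beta> \<alpha>' \<beta>'
    by (rule hspace_eqI) (auto simp: mult_closed block_scalar_closed mult_block_scalar_coord)
  then have "mult H x y \<in> block_scalars" if "x \<in> block_scalars" "y \<in> block_scalars" for x y
    using that by blast
  moreover have "comult H ` block_scalars \<subseteq> cfun.span {a \<otimes> x |a x. a \<in> hspace H \<and> x \<in> block_scalars}"
  proof (intro image_subsetI)
    fix x assume "x \<in> block_scalars"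
    then obtain \<alpha> \<beta> where x: "x = block_scalar \<alpha> \<beta>" by blast
    show "comult H x \<in> cfun.span {a \<otimes> x |a x. a \<in> hspace H \<and> x \<in> block_scalars}"
      unfolding x comult_block_scalar
      by (intro cfun.span_add cfun.span_base) (use block_scalar_closed in blast)+
  qed
  moreover have "cfun.subspace block_scalars"
    unfolding cfun.subspace_def by (auto simp: block_scalar_linear(1,2)) (metis block_scalar_linear(3), blast+)
  moreover have "block_scalars \<subseteq> hspace H" "sekine_unity k \<in> block_scalars"
    using block_scalar_closed unity_block_scalar by blast+
  ultimately show ?thesis
    by (simp only: left_coideal_subalgebra_def unital_subalgebra_def sekine_sel) blast
qed

text \<open>On \<open>D\<close> coordinates the product is pointwise, so \<Delta>(a) is read at an
  index pair and its negative. They add up to zero, and the coefficient there is the counit.\<close>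

lemma adj_D:
  assumes "m \<in> R" "n \<in> R"
  shows "adj H a b (D m n) = a (D 0 0) * b (D m n)"
proof -
  have "adj H a b (D m n) = (\<Sum>p\<in>basis H. \<Sum>q\<in>basis H. (comult H a (p, q) * b (D m n)) *
      (bvec p (D m n) * bvec q (neg_index (D m n))))"
    using assms by (simp add: adj_def sweedler_apply mult_coord antipode_coord mult_ac)
  also have "\<dots> = comult H a (D m n, neg_index (D m n)) * b (D m n)"
    using assms by (intro sum_bvec2) auto
  also have "\<dots> = a (D 0 0) * b (D m n)"
    using assms by (simp add: comult_coord mod_simps)
  finally show ?thesis .
qed

abbreviation "e\<^sub>D \<equiv> block_scalar 1 0"

text \<open>Both factors vanish on the matrix block and multiply pointwise elsewhere, so the corner
  is its own center.\<close>

lemma right_mult_e_D_commute: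
  "mult H (mult H x e\<^sub>D) (mult H y e\<^sub>D) = mult H (mult H y e\<^sub>D) (mult H x e\<^sub>D)"
  by (rule hspace_eqI[OF mult_closed mult_closed])
    (auto simp: mult_coord mult_block_scalar_coord)

section \<open>The chain, its integrals, nilpotency and solvability\<close>

definition sekine_chain :: "nat \<Rightarrow> (sekine_index \<Rightarrow> complex) set" where
  "sekine_chain j = (if j = 0 then cfun.span {sekine_unity k}
    else if j = 1 then block_scalars else hspace H)"

definition chain_length :: nat where
  "chain_length = (if k = 1 then 1 else 2)"

lemma span_unity: "cfun.span {sekine_unity k} = {block_scalar c c |c. True}"
  by (auto simp: cfun.span_singleton unity_block_scalar block_scalar_linear)

lemma sekine_chain_top: "sekine_chain chain_length = hspace H"
proof (cases "k = 1")
  case True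
  then have R: "R = {0}"
    by (auto simp: residues_def)
  have "x = block_scalar (x (D 0 0)) (x (E 0 0))" if "x \<in> hspace H" for x
    using that by (intro hspace_eqI) (auto simp: block_scalar_closed R)
  then have "block_scalars = hspace H"
    using block_scalar_closed by blast
  then show ?thesis
    by (simp add: sekine_chain_def chain_length_def)
qed (simp add: sekine_chain_def chain_length_def)

lemma sekine_chain_strict:
  assumes "j < chain_length"
  shows "sekine_chain j \<subset> sekine_chain (Suc j)"
proof (cases "j = 0")
  case True
  have "e\<^sub>D \<noteq> block_scalar c c" for c
    by (metis block_scalar.simps zero_R zero_neq_one)
  then have "e\<^sub>D \<in> block_scalars - {block_scalar c c |c. True}"
    by auto
  with True show ?thesis
    by (auto simp: sekine_chain_def span_unity)
next
  case False
  then have j: "j = 1" and k: "k \<ge> 2"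
    using assms k_pos by (auto simp: chain_length_def split: if_splits)
  then have R: "1 \<in> R"
    by (simp add: residues_def)
  \<comment> \<open>A block scalar is constant on the \<open>D\<close> indices, while
    \<open>bvec (D 0 0)\<close> separates \<open>D 0 0\<close> from \<open>D 0 1\<close>; the latter
    index exists because \<open>k\<close> is at least 2.\<close>
  have "bvec (D 0 0) \<noteq> block_scalar \<alpha> \<beta>" for \<alpha> \<beta>
  proof
    assume eq: "bvec (D 0 0) = block_scalar \<alpha> \<beta>"
    show False
      using fun_cong[OF eq, of "D 0 0"] fun_cong[OF eq, of "D 0 1"] R by (simp add: bvec_def)
  qed
  then have "bvec (D 0 0) \<in> hspace H - block_scalars"
    by auto
  moreover have "block_scalars \<subseteq> hspace H"
    using block_scalar_closed by auto
  ultimately have "block_scalars \<subset> hspace H"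
    by blast
  with j show ?thesis
    by (simp add: sekine_chain_def)
qed

lemma sekine_chain_normal: "normal_left_coideal_subalgebra H (sekine_chain j)"
proof -
  have "cfun.span {sekine_unity k} \<subseteq> center H (hspace H)" "block_scalars \<subseteq> center H (hspace H)"
    using block_scalar_central unfolding span_unity by blast+
  then show ?thesis
    using normal_of_central left_coideal_subalgebra_unity left_coideal_subalgebra_block_scalars
      normal_left_coideal_subalgebra_hspace
    by (simp add: sekine_chain_def)
qed

lemma is_integral_unity: "is_integral H (sekine_chain 0) (sekine_unity k)"
proof -
  have "sekine_unity k \<noteq> 0"
    by (metis unity_coord(1) zero_R zero_fun_apply zero_neq_one)
  then show ?thesis
    using cfun.span_base[of "sekine_unity k" "{sekine_unity k}"]
    by (auto simp: is_integral_def sekine_chain_def cfun.span_singleton mult_scale mult_unity_sekine unity_closed_sekine counit_coord unity_coord)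
qed

text \<open>Multiplying \<open>e\<^sub>D\<close> by a block scalar keeps only \<alpha>, and \<alpha>
  is also the counit, being the coefficient at \<open>D 0 0\<close>.\<close>

lemma is_integral_e_D: "is_integral H (sekine_chain 1) e\<^sub>D"
proof -
  have "e\<^sub>D \<noteq> 0"
    by (metis block_scalar.simps(1) zero_R zero_fun_apply zero_neq_one)
  moreover have "mult H e\<^sub>D (block_scalar \<alpha> \<beta>) = counit H (block_scalar \<alpha> \<beta>) *\<^sub>C e\<^sub>D"
    "mult H (block_scalar \<alpha> \<beta>) e\<^sub>D = counit H (block_scalar \<alpha> \<beta>) *\<^sub>C e\<^sub>D" for \<alpha> \<beta>
    by (rule hspace_eqI; auto simp: mult_closed block_scalar_closed mult_block_scalar_coord counit_coord
        intro!: cfun.subspace_scale subspace_hspace)+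
  ultimately show ?thesis
    by (auto simp: is_integral_def sekine_chain_def)
qed

lemma nilpotent_sekine: "nilpotent H"
  unfolding nilpotent_def
proof (rule exI, rule exI, intro conjI allI impI)
  show "sekine_chain 0 = cfun.span {unity H}" "sekine_chain chain_length = hspace H"
    using sekine_chain_top by (simp_all add: sekine_chain_def)
  show "normal_left_coideal_subalgebra H (sekine_chain j)" for j
    by (rule sekine_chain_normal)
  fix j assume j: "j < chain_length"
  then show "sekine_chain j \<subset> sekine_chain (Suc j)"
    by (rule sekine_chain_strict)
  consider "j = 0" | "j = 1"
    using j by (auto simp: chain_length_def less_2_cases_iff split: if_splits)
  then show "\<exists>l. is_integral H (sekine_chain j) l \<and>
      right_mult_set H (sekine_chain (Suc j)) l \<subseteq> center H (right_mult_set H (hspace H) l)"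
  proof cases
    case 1
    \<comment> \<open>The integral of the bottom term is the unit, so this step only asks that the
      middle term be central in the whole algebra.\<close>
    have "right_mult_set H L (sekine_unity k) = L" if "L \<subseteq> hspace H" for L
    proof -
      have "mult H x (sekine_unity k) = x" if "x \<in> L" for x
        using that \<open>L \<subseteq> hspace H\<close> by (intro mult_unity_sekine) blast
      moreover have "right_mult_set H L (sekine_unity k) = (\<lambda>x. mult H x (sekine_unity k)) ` L"
        by (auto simp: right_mult_set_def)
      ultimately show ?thesis
        by (simp cong: image_cong)
    qed
    moreover have "block_scalars \<subseteq> hspace H" "block_scalars \<subseteq> center H (hspace H)"
      using block_scalar_closed block_scalar_central by blast+
    ultimately have "right_mult_set H (sekine_chain (Suc j)) (sekine_unity k)
        \<subseteq> center H (right_mult_set H (hspace H) (sekine_unity k))"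
      using 1 by (simp add: sekine_chain_def)
    with 1 is_integral_unity show ?thesis by blast
  next
    case 2
    have "right_mult_set H (sekine_chain (Suc j)) e\<^sub>D \<subseteq> center H (right_mult_set H (hspace H) e\<^sub>D)"
      using 2 right_mult_e_D_commute by (auto simp: sekine_chain_def center_def right_mult_set_def)
    with 2 is_integral_e_D show ?thesis by blast
  qed
qed

text \<open>The chain that serves for nilpotency works for every \<open>k\<close>; the value 15
  enters only when the locale is instantiated.\<close>

lemma solvable_sekine: "solvable H"
  unfolding solvable_def
proof (rule exI, rule exI, intro conjI allI impI)
  show "sekine_chain 0 = cfun.span {unity H}" "sekine_chain chain_length = hspace H"
    using sekine_chain_top by (simp_all add: sekine_chain_def)
  show "left_coideal_subalgebra H (sekine_chain j)" for j
    using sekine_chain_normal[of j] by (simp add: normal_left_coideal_subalgebra_def)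
  fix j assume j: "j < chain_length"
  then show "sekine_chain j \<subset> sekine_chain (Suc j)"
    by (rule sekine_chain_strict)
  consider "j = 0" | "j = 1"
    using j by (auto simp: chain_length_def less_2_cases_iff split: if_splits)
  then show "\<exists>l. is_integral H (sekine_chain j) l \<and> l \<in> center H (sekine_chain (Suc j)) \<and>
      (\<forall>a\<in>sekine_chain (Suc j). \<forall>b\<in>sekine_chain (Suc j).
        mult H (adj H a b) l = counit H a *\<^sub>C mult H b l)"
  proof cases
    case 1
    have "mult H (adj H a b) (sekine_unity k) = counit H a *\<^sub>C mult H b (sekine_unity k)"
      if "a \<in> block_scalars" "b \<in> block_scalars" for a b
    proof -
      have "a \<in> hspace H" "b \<in> hspace H" "b \<in> center H (hspace H)"
        using that block_scalar_central block_scalar_closed by auto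
      then show ?thesis
        by (simp add: adj_central mult_scale)
    qed
    moreover have "sekine_unity k \<in> center H block_scalars"
    proof -
      have "mult H (sekine_unity k) x = mult H x (sekine_unity k)" if "x \<in> block_scalars" for x
        using that block_scalar_closed mult_unity_sekine[of x] by auto
      moreover have "sekine_unity k \<in> block_scalars"
        using unity_block_scalar by blast
      ultimately show ?thesis
        by (simp only: center_def mem_Collect_eq) blast
    qed
    ultimately show ?thesis
      using 1 is_integral_unity
      by (intro exI[of _ "sekine_unity k"]) (simp only: sekine_chain_def, simp)
  next
    case 2
    \<comment> \<open>Right multiplication by \<open>e\<^sub>D\<close> kills the matrix coordinates,
      and on the others \<open>adj_D\<close> already gives the counit as a scalar.\<close>
    have "mult H (adj H a b) e\<^sub>D = counit H a *\<^sub>C mult H b e\<^sub>D" for a b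
      by (rule hspace_eqI) (auto simp: mult_closed mult_block_scalar_coord adj_D counit_coord
          intro!: cfun.subspace_scale subspace_hspace)
    moreover have "e\<^sub>D \<in> center H (hspace H)"
      by (rule block_scalar_central)
    ultimately show ?thesis
      using 2 is_integral_e_D by (auto simp: sekine_chain_def)
  qed
qed

lemma dim_sekine: "cfun.dim (hspace H) = 2 * k\<^sup>2"
proof -
  have "card (basis H) = card ((\<lambda>(i, j). D i j) ` (R \<times> R)) + card ((\<lambda>(i, j). E i j) ` (R \<times> R))"
    unfolding basis_eq by (rule card_Un_disjoint) auto
  also have "\<dots> = 2 * k\<^sup>2"
    by (subst (1 2) card_image) (auto simp: inj_on_def power2_eq_square)
  finally show ?thesis
    by (simp add: dim_hspace)
qed

end

theorem theorem3p5:
  shows "(\<forall>k::nat. k \<ge> 1 \<longrightarrow> semisimple_hopf_algebra (sekine k) \<and> nilpotent (sekine k)) \<and>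
    hopf_algebra (sekine 15) \<and> solvable (sekine 15) \<and>
    cfun.dim (hspace (sekine 15)) = 2 * 3^2 * 5^2"
proof (intro conjI allI impI)
  fix k :: nat assume "k \<ge> 1"
  then interpret sekine_data k by unfold_locales
  show "semisimple_hopf_algebra (sekine k)" "nilpotent (sekine k)"
    by (rule semisimple_sekine nilpotent_sekine)+
next
  interpret sekine_data 15 by unfold_locales simp
  show "hopf_algebra (sekine 15)" "solvable (sekine 15)"
    by (rule hopf_algebra_sekine solvable_sekine)+
  show "cfun.dim (hspace (sekine 15)) = 2 * 3^2 * 5^2"
    by (simp add: dim_sekine)
qed

end
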